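(* Let $\mathfrak G=(G,(\mathcal H_v)_{v\in V},(T_e)_{e\in E})$ be a graph of matrices, with $\mathcal H_v=\mathbb C^{N_v}$. Let $$S(\mathfrak G):=\sum_{i:V\to\mathbb N}\ \prod_{e\in E}\langle \xi_{i_{t(e)}},T_e\,\xi_{i_{s(e)}}\rangle,$$ where the sum runs over all functions $i:V\to\mathbb N$ such that $1\le i(v)\le N_v$ for each $v\in V$. Let $\mathfrak F=\mathfrak F(G)$ be the forest of two-edge connected components of $G$. Then $$|S(\mathfrak G)|\le\prod_{\mathfrak l\text{ leaf of }\mathfrak F}\Bigl(\max_{v\in\mathfrak l}\dim\mathcal H_v\Bigr)^{\mathfrak r(\mathfrak l)}\cdot\prod_{e\in E}\|T_e\|,$$ where, for a leaf $\mathfrak l$, $v$ runs over all vertices in the two-edge connected component of $G$ corresponding to $\mathfrak l$, and $$\mathfrak r(\mathfrak l):=\begin{cases}1,&\text{if }\mathfrak l\text{ is a trivial leaf},\\ \tfrac12,&\text{if }\mathfrak l\text{ is a leaf of a non-trivial tree}.\end{cases}$$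
   Context: Graphs are finite. A graph of matrices is a triple $\mathfrak G=(G,(\mathcal H_v)_{v\in V},(T_e)_{e\in E})$ in which $G=(V,E)$ is a directed graph (possibly with multiple edges and loops), each $\mathcal H_v=\mathbb C^{N_v}$ ($N_v\ge1$) is a finite-dimensional Hilbert space with the standard inner product (linear in the second variable), and $T_e:\mathcal H_{s(e)}\to\mathcal H_{t(e)}$ is a linear operator, where $s(e)$ and $t(e)$ are the source and target of the edge $e$. For each $v$, $\{\xi_1,\dots,\xi_{N_v}\}$ denotes the standard orthonormal basis of $\mathcal H_v$; for a function $i$ on vertices, $i_v=i(v)$ and $\xi_{i_v}$ denotes the corresponding basis vector of $\mathcal H_v$. $\|\cdot\|$ is the operator norm. The following notions ignore edge orientations. A cutting edge of a connected graph is an edge whose removal would result in two disconnected subgraphs (for a general graph, a cutting edge is a cutting edge of one of its connected components). A connected graph is two-edge connected if it does not contain a cutting edge (in particular, a single vertex is two-edge connected). A two-edge connected component of a graph is a subgraph which is two-edge connected and cannot be enlarged to a bigger two-edge connected subgraph. The forest of two-edge connected components $\mathfrak F(G)$ is the graph whose vertices are the two-edge connected components of $G$, two distinct vertices being connected by an edge if there is a cutting edge of $G$ between vertices from the two corresponding components; it has no cycles. A forest is a graph without cycles; a tree is a connected component of a forest. A tree is trivial if it consists of only one vertex. A leaf of a non-trivial tree is a vertex which meets only one edge. The sole vertex of a trivial tree is also a leaf, called a trivial leaf. *)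

theory Defs
  imports
    "Graph_Theory.Graph_Theory"
    "Jordan_Normal_Form.Matrix"
    "HOL-Library.FuncSet"
begin

text \<open>Directed multigraphs are the \<open>pre_digraph\<close> records of \<open>Graph_Theory\<close>; there
  \<open>Digraph_Component.connected\<close> ignores orientations and demands at least one vertex. Subgraphs
  keep the \<open>tail\<close> and \<open>head\<close> maps of the ambient graph, so they are determined by their
  vertices and arcs.\<close>

definition conn_components :: "('a, 'b) pre_digraph \<Rightarrow> ('a, 'b) pre_digraph set" where
  "conn_components G = {K. pre_digraph.max_subgraph G Digraph_Component.connected K}"

definition disconnecting_edge :: "('a, 'b) pre_digraph \<Rightarrow> 'b \<Rightarrow> bool" where
  "disconnecting_edge K e \<longleftrightarrow>
     e \<in> arcs K \<and> \<not> Digraph_Component.connected (pre_digraph.del_arc K e)"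

definition cutting_edges :: "('a, 'b) pre_digraph \<Rightarrow> 'b set" where
  "cutting_edges G = {e. \<exists>K \<in> conn_components G. disconnecting_edge K e}"

definition two_edge_connected :: "('a, 'b) pre_digraph \<Rightarrow> bool" where
  "two_edge_connected H \<longleftrightarrow>
     Digraph_Component.connected H \<and> (\<nexists>e. disconnecting_edge H e)"

definition tec_components :: "('a, 'b) pre_digraph \<Rightarrow> ('a, 'b) pre_digraph set" where
  "tec_components G = {C. pre_digraph.max_subgraph G two_edge_connected C}"

text \<open>The forest of two-edge connected components is an undirected simple graph, encoded as a
  symmetric loop-free relation: an undirected edge between \<open>C\<close> and \<open>D\<close> is the pair of arcs
  \<open>(C, D)\<close> and \<open>(D, C)\<close>.\<close>

definition tec_forest ::
  "('a, 'b) pre_digraph \<Rightarrow>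
     (('a, 'b) pre_digraph, ('a, 'b) pre_digraph \<times> ('a, 'b) pre_digraph) pre_digraph" where
  "tec_forest G = with_proj
     \<lparr> pverts = tec_components G,
       parcs = {(C, D). C \<in> tec_components G \<and> D \<in> tec_components G \<and> C \<noteq> D \<and>
         (\<exists>e \<in> cutting_edges G.
            (tail G e \<in> verts C \<and> head G e \<in> verts D) \<or>
            (tail G e \<in> verts D \<and> head G e \<in> verts C))} \<rparr>"

definition trivial_leaf :: "('v, 'v \<times> 'v) pre_digraph \<Rightarrow> 'v \<Rightarrow> bool" where
  "trivial_leaf F l \<longleftrightarrow> (\<exists>R \<in> conn_components F. verts R = {l})"

text \<open>In the symmetric encoding the number of undirected edges meeting \<open>l\<close> is the
  out-degree of \<open>l\<close>.\<close>

definition nontrivial_leaf :: "('v, 'v \<times> 'v) pre_digraph \<Rightarrow> 'v \<Rightarrow> bool" where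
  "nontrivial_leaf F l \<longleftrightarrow>
     (\<exists>R \<in> conn_components F. l \<in> verts R \<and> verts R \<noteq> {l} \<and> out_degree R l = 1)"

definition leaves :: "('v, 'v \<times> 'v) pre_digraph \<Rightarrow> 'v set" where
  "leaves F = {l. trivial_leaf F l \<or> nontrivial_leaf F l}"

definition leaf_exponent :: "('v, 'v \<times> 'v) pre_digraph \<Rightarrow> 'v \<Rightarrow> real" where
  "leaf_exponent F l = (if trivial_leaf F l then 1 else 1 / 2)"

text \<open>The inner product is linear in its second argument, whereas \<open>(\<bullet>c)\<close> is linear in its
  first.\<close>

definition cinner :: "complex vec \<Rightarrow> complex vec \<Rightarrow> complex" where
  "cinner x y = y \<bullet>c x"

definition vec_l2_norm :: "complex vec \<Rightarrow> real" where
  "vec_l2_norm x = sqrt (Re (cinner x x))"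

definition op_norm :: "complex mat \<Rightarrow> real" where
  "op_norm A =
     (SUP x \<in> {x \<in> carrier_vec (dim_col A). vec_l2_norm x \<le> 1}. vec_l2_norm (A *\<^sub>v x))"

text \<open>The space at vertex \<open>v\<close> is \<open>carrier_vec (N v)\<close>, of dimension \<open>N v\<close>; operators are
  given by their matrices in the standard bases.\<close>

locale graph_of_matrices = fin_digraph G
  for G :: "('a, 'b) pre_digraph" +
  fixes N :: "'a \<Rightarrow> nat" and T :: "'b \<Rightarrow> complex mat"
  assumes dim_pos: "v \<in> verts G \<Longrightarrow> N v \<ge> 1"
    and T_carrier: "e \<in> arcs G \<Longrightarrow> T e \<in> carrier_mat (N (head G e)) (N (tail G e))"

text \<open>Basis vectors are indexed from \<open>0\<close>, so an index function takes values \<open>i v < N v\<close>. It is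
  \<open>undefined\<close> outside \<open>verts G\<close>, so that each function on the vertices is counted once.\<close>

definition graph_sum ::
  "('a, 'b) pre_digraph \<Rightarrow> ('a \<Rightarrow> nat) \<Rightarrow> ('b \<Rightarrow> complex mat) \<Rightarrow> complex" where
  "graph_sum G N T =
     (\<Sum>i \<in> (\<Pi>\<^sub>E v\<in>verts G. {..<N v}).
        \<Prod>e \<in> arcs G.
          cinner (unit_vec (N (head G e)) (i (head G e)))
                 (T e *\<^sub>v unit_vec (N (tail G e)) (i (tail G e))))"

end

theory Submission
  imports Defs "HOL-Analysis.Convex"
begin

text \<open>
  Adjoin to \<open>G\<close> a root with a one-dimensional space. From one vertex \<open>v\<close> of
  every leaf of the forest draw an edge to the root, carrying the row of \<open>N v\<close> ones, which has norm
  \<open>sqrt (N v)\<close>; from a vertex of a trivial leaf draw two such edges. The sum does not change, since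
  the root has one index only and the new matrix entries are all \<open>1\<close>, and the norms of the new edges
  multiply up to at most the factor that the theorem assigns to the leaves. What is gained is that the
  closed graph has no thin cuts: every nonempty set of vertices without the root is left by at
  least two edges (\<open>closure_no_thin_cut\<close>). It remains to bound the sum of such a graph by the
  product of the norms alone, times the dimension of the root (\<open>contraction_bound\<close>).

  Suppose that the edges can be listed so that each of them can
  be directed from \<open>u\<close> to \<open>w\<close>, where \<open>u\<close> is the root or lies on an earlier edge and \<open>w\<close> is the root
  or lies on a later edge; call this a sweep. At every moment keep the tensor obtained by summing
  over the indices of all vertices whose edges have been used up. Its indices belong to the
  active vertices: the root and those with both used and unused edges. One step of the sweep
  multiplies by an
  entry of \<open>T e\<close>, gives an index to \<open>w\<close> if \<open>w\<close> has none, and sums over the index of \<open>u\<close> if this was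
  its last edge. Because \<open>u\<close> had an index before and \<open>w\<close> has one after the step, the \<open>l2\<close> norm of the
  tensor grows at most by the factor \<open>op_norm (T e)\<close>: according to the case, this bounds an entry, a
  column, a row, or the matrix as an operator (\<open>sq_norm_apply_edge\<close>). A sweep exists whenever there
  are no thin cuts (\<open>sweep_exists\<close>), because a sweep of some of the edges can be enlarged by an ear,
  that is, by a walk outside of it which starts and ends on it.

  Consider a minimal nonempty set \<open>Z\<close> of vertices of \<open>G\<close> that at most one
  edge leaves. It spans a two-edge connected component, which is a leaf of the forest: a trivial
  one if no edge leaves \<open>Z\<close>, and a leaf of a non-trivial tree if one does. Thus every set that at
  most one edge leaves contains a leaf (\<open>thin_cut_contains_leaf\<close>). If this leaf is trivial, its two
  edges to the root leave the set; if an edge of \<open>G\<close> leaves the set, the one edge from the leaf to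
  the root makes two. In the remaining case the set without the leaf is left by a single edge, and
  so it contains a second leaf.
\<close>

section \<open>Sweeping a multigraph from a root\<close>

context
  fixes s t :: "'e \<Rightarrow> 'v"
begin

definition joins :: "'e \<Rightarrow> 'v \<Rightarrow> 'v \<Rightarrow> bool" where
  "joins e u w \<longleftrightarrow> s e = u \<and> t e = w \<or> s e = w \<and> t e = u"

definition crosses :: "'v set \<Rightarrow> 'e \<Rightarrow> bool" where
  "crosses Z e \<longleftrightarrow> (s e \<in> Z) \<noteq> (t e \<in> Z)"

definition thin_cut :: "'e set \<Rightarrow> 'v set \<Rightarrow> bool" where
  "thin_cut E Z \<longleftrightarrow> (\<exists>f. \<forall>e\<in>E. crosses Z e \<longrightarrow> e = f)"

definition touched :: "'e list \<Rightarrow> 'v set" where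
  "touched es = s ` set es \<union> t ` set es"

lemma touched_simps [simp]:
  "touched [] = {}"
  "touched (e # es) = {s e, t e} \<union> touched es"
  "touched (es @ fs) = touched es \<union> touched fs"
  by (auto simp: touched_def)

fun walk :: "'v \<Rightarrow> 'e list \<Rightarrow> 'v \<Rightarrow> bool" where
  "walk u [] w \<longleftrightarrow> u = w"
| "walk u (e # es) w \<longleftrightarrow> (\<exists>v. joins e u v \<and> walk v es w)"

text \<open>The set \<open>X\<close> consists of the vertices reached before the list is processed, and \<open>Y\<close> of those still
  needed afterwards; a full sweep from the root \<open>r\<close> has \<open>X = Y = {r}\<close>. The asymmetry between \<open>u\<close>
  and \<open>w\<close> forces every other vertex on a full sweep to meet it at least twice: the first time its
  partner was reached earlier, the last time its partner is still needed later, and these two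
  edges differ.\<close>

fun sweep :: "'v set \<Rightarrow> 'e list \<Rightarrow> 'v set \<Rightarrow> bool" where
  "sweep X [] Y \<longleftrightarrow> True"
| "sweep X (e # es) Y \<longleftrightarrow>
     (\<exists>u\<in>X. \<exists>w \<in> Y \<union> touched es. joins e u w) \<and> sweep (X \<union> {s e, t e}) es Y"

lemma sweep_append:
  "sweep X (es @ fs) Y \<longleftrightarrow> sweep X es (Y \<union> touched fs) \<and> sweep (X \<union> touched es) fs Y"
  by (induction es arbitrary: X) (auto simp: Un_ac)

lemma sweep_mono: "sweep X es Y \<Longrightarrow> X \<subseteq> X' \<Longrightarrow> Y \<subseteq> Y' \<Longrightarrow> sweep X' es Y'"
proof (induction es arbitrary: X X')
  case (Cons e es)
  have "sweep (X' \<union> {s e, t e}) es Y'"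
    by (rule Cons.IH[of "X \<union> {s e, t e}"]) (use Cons.prems in auto)
  with Cons.prems show ?case by auto
qed simp

lemma walk_append: "walk u (es @ fs) w \<longleftrightarrow> (\<exists>v. walk u es v \<and> walk v fs w)"
  by (induction es arbitrary: u) auto

lemma joins_ends: "joins e u w \<Longrightarrow> {s e, t e} = {u, w}"
  by (auto simp: joins_def)

lemma joins_sym: "joins e u w \<Longrightarrow> joins e w u"
  by (auto simp: joins_def)

lemma walk_rev: "walk u es w \<Longrightarrow> walk w (rev es) u"
  by (induction es arbitrary: u) (auto simp: walk_append dest: joins_sym)

lemma walk_last_touched: "walk u es w \<Longrightarrow> u = w \<or> w \<in> touched es"
  by (induction es arbitrary: u) (auto simp: joins_def)

lemma walk_first_touched: "walk u es w \<Longrightarrow> u = w \<or> u \<in> touched es"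
  by (cases es) (auto simp: joins_def)

text \<open>Along a walk every vertex is entered by the edge before it and left by the edge after it. The
  walk may revisit vertices.\<close>

lemma walk_imp_sweep: "walk u es w \<Longrightarrow> u \<in> X \<Longrightarrow> w \<in> Y \<Longrightarrow> sweep X es Y"
proof (induction es arbitrary: u X)
  case (Cons e es)
  then obtain v where v: "joins e u v" "walk v es w" by auto
  have "v \<in> Y \<union> touched es" using walk_first_touched[OF v(2)] Cons.prems by auto
  moreover have "sweep (X \<union> {s e, t e}) es Y"
    using Cons.IH[OF v(2)] v(1) Cons.prems by (auto simp: joins_def)
  ultimately show ?case using v Cons.prems by auto
qed simp

lemma sweep_insert_walk:
  assumes "sweep R (xs @ ys) R" "walk u fs w" "u \<in> R \<union> touched xs" "w \<in> R \<union> touched ys"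
  shows "sweep R (xs @ fs @ ys) R"
  using assms walk_imp_sweep[OF assms(2,3,4)]
  by (auto simp: sweep_append Un_ac intro: sweep_mono)

text \<open>If no cut of the list has one of \<open>u\<close>, \<open>w\<close> reached before it and the other still needed after it,
  then \<open>u\<close> and \<open>w\<close> both meet only one edge of the list, and this is the same edge. A sweep
  directs this edge from a vertex reached earlier to one needed later, but its end \<open>u\<close> is neither.\<close>

lemma sweep_separates:
  assumes "sweep R es R" "u \<in> R \<union> touched es" "w \<in> R \<union> touched es"
  shows "\<exists>xs ys. es = xs @ ys \<and>
    (u \<in> R \<union> touched xs \<and> w \<in> R \<union> touched ys \<or> w \<in> R \<union> touched xs \<and> u \<in> R \<union> touched ys)"
proof (rule ccontr)
  assume contra: "\<not> ?thesis"
  then have no_split: "\<not> (u \<in> R \<union> touched xs \<and> w \<in> R \<union> touched ys)"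
     "\<not> (w \<in> R \<union> touched xs \<and> u \<in> R \<union> touched ys)" if "es = xs @ ys" for xs ys
    using that by blast+
  have notR: "u \<notin> R" "w \<notin> R"
    using no_split[of "[]" es] no_split[of es "[]"] assms by auto
  then have "\<exists>e\<in>set es. u \<in> {s e, t e}"
    using assms by (auto simp: touched_def)
  then obtain xs e ys where es: "es = xs @ e # ys" and u: "u \<in> {s e, t e}"
    and u_xs: "\<forall>e\<in>set xs. u \<notin> {s e, t e}"
    using split_list_first_prop[of es "\<lambda>e. u \<in> {s e, t e}"] by blast
  \<comment> \<open>Cutting directly after or directly before \<open>e\<close>, the first edge at \<open>u\<close>, leaves \<open>w\<close> no other edge.\<close>
  have 1: "w \<notin> touched ys" using no_split[of "xs @ [e]" ys] es u notR by auto
  have 2: "w \<notin> touched xs" using no_split[of xs "e # ys"] es u notR by auto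
  have w: "w \<in> {s e, t e}" using 1 2 assms notR es by auto
  have 3: "u \<notin> touched ys" using no_split[of "xs @ [e]" ys] es w notR by auto
  have 4: "u \<notin> touched xs" using u_xs by (auto simp: touched_def)
  obtain a b where ab: "a \<in> R \<union> touched xs" "b \<in> R \<union> touched ys" "joins e a b"
    using assms(1) unfolding es sweep_append by auto
  have "u \<noteq> a" "w \<noteq> a" "u \<noteq> b" "w \<noteq> b" using 1 2 3 4 ab notR by auto
  then show False using joins_ends[OF ab(3)] u by auto
qed

text \<open>The ear is inserted as a block at a moment when its starting vertex is already reached and its
  final vertex is still needed; for this the ear may have to be traversed backwards.\<close>

lemma sweep_insert_ear:
  assumes "sweep R es R" "u \<in> R \<union> touched es" "w \<in> R \<union> touched es" "walk u fs w"
  shows "\<exists>xs ys gs. es = xs @ ys \<and> (gs = fs \<or> gs = rev fs) \<and> sweep R (xs @ gs @ ys) R"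
  using sweep_separates[OF assms(1-3)] sweep_insert_walk assms(1,4) walk_rev[OF assms(4)]
  by blast

lemma walk_distinct:
  "walk u es w \<Longrightarrow> \<exists>fs. walk u fs w \<and> distinct fs \<and> set fs \<subseteq> set es"
proof (induction es arbitrary: u)
  case Nil
  then show ?case by (auto intro: exI[of _ "[]"])
next
  case (Cons e es)
  then obtain v where v: "joins e u v" "walk v es w" by auto
  obtain fs where fs: "walk v fs w" "distinct fs" "set fs \<subseteq> set es" using Cons.IH[OF v(2)] by blast
  show ?case
  proof (cases "e \<in> set fs")
    case False
    then show ?thesis using fs v by (intro exI[of _ "e # fs"]) auto
  next
    case True
    then obtain as bs where ab: "fs = as @ e # bs" by (meson split_list)
    \<comment> \<open>The walk uses \<open>e\<close> twice: depending on the two directions, the detour in between can be replaced by \<open>e\<close> or the loop at \<open>u\<close> can be removed altogether.\<close>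
    obtain p q where pq: "joins e p q" "walk q bs w"
      using fs(1) by (auto simp: ab walk_append)
    have "p = u \<and> q = v \<or> p = v \<and> q = u" using v(1) pq(1) by (auto simp: joins_def)
    then show ?thesis
    proof
      assume "p = u \<and> q = v"
      then show ?thesis using fs pq ab by (intro exI[of _ "e # bs"]) auto
    next
      assume "p = v \<and> q = u"
      then show ?thesis using fs pq ab by (intro exI[of _ bs]) auto
    qed
  qed
qed

lemma walk_stop_at:
  "walk u es w \<Longrightarrow> w \<in> U \<Longrightarrow>
    \<exists>fs z. walk u fs z \<and> z \<in> U \<and> set fs \<subseteq> set es \<and> (\<forall>e\<in>set fs. \<not> {s e, t e} \<subseteq> U)"
proof (induction es arbitrary: u)
  case Nil
  then show ?case by (auto intro: exI[of _ "[]"])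
next
  case (Cons e es)
  then obtain v where v: "joins e u v" "walk v es w" by auto
  show ?case
  proof (cases "u \<in> U")
    case True
    then show ?thesis by (intro exI[of _ "[]"]) auto
  next
    case False
    obtain fs z where "walk v fs z" "z \<in> U" "set fs \<subseteq> set es" "\<forall>e\<in>set fs. \<not> {s e, t e} \<subseteq> U"
      using Cons.IH[OF v(2)] Cons.prems by blast
    then show ?thesis using v False by (intro exI[of _ "e # fs"] exI[of _ z]) (auto simp: joins_def)
  qed
qed

text \<open>Start from \<open>U\<close> along an edge \<open>f\<close> outside \<open>F\<close>. The vertices reachable from its far end without \<open>f\<close>
  form a set whose only boundary edge can be \<open>f\<close>, so this set cannot avoid \<open>U\<close>. Every edge of \<open>F\<close>
  has both ends in \<open>U\<close>, so that stopping the return walk at its first vertex in \<open>U\<close> keeps it outside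
  \<open>F\<close>.\<close>

lemma ear_exists:
  assumes sub: "\<And>e. e \<in> E \<Longrightarrow> s e \<in> V \<and> t e \<in> V"
    and cut: "\<And>Z. Z \<subseteq> V \<Longrightarrow> Z \<noteq> {} \<Longrightarrow> r \<notin> Z \<Longrightarrow> \<not> thin_cut E Z"
    and F: "F \<subset> E" and U: "U = insert r (s ` F \<union> t ` F)"
  shows "\<exists>u\<in>U. \<exists>w\<in>U. \<exists>fs. walk u fs w \<and> distinct fs \<and> fs \<noteq> [] \<and> set fs \<subseteq> E - F"
proof -
  have "\<exists>f\<in>E - F. s f \<in> U \<or> t f \<in> U"
  proof (rule ccontr)
    assume none: "\<not> ?thesis"
    obtain f where f: "f \<in> E - F" using F by auto
    have "V - U \<noteq> {}" using f none sub by blast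
    moreover have "thin_cut E (V - U)"
      using none sub U unfolding thin_cut_def crosses_def by blast
    ultimately show False using cut[of "V - U"] U by auto
  qed
  then obtain f u x where f: "f \<in> E - F" "u \<in> U" "joins f u x" by (auto simp: joins_def)
  have x: "x \<in> V" using f sub by (auto simp: joins_def)
  define Z where "Z = {z. \<exists>es. set es \<subseteq> E - {f} \<and> walk x es z}"
  have "\<exists>es w. set es \<subseteq> E - {f} \<and> walk x es w \<and> w \<in> U"
  proof (rule ccontr)
    assume "\<not> ?thesis"
    then have ZU: "Z \<inter> U = {}" by (auto simp: Z_def)
    have xZ: "x \<in> Z" unfolding Z_def by (auto intro: exI[of _ "[]"])
    have ZV: "Z \<subseteq> V"
    proof
      fix z assume "z \<in> Z"
      then obtain es where "set es \<subseteq> E - {f}" "walk x es z" by (auto simp: Z_def)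
      then show "z \<in> V" using walk_last_touched[of x es z] x sub by (auto simp: touched_def)
    qed
    have step: "q \<in> Z" if pq: "p \<in> Z" "joins e p q" "e \<in> E - {f}" for e p q
    proof -
      obtain es where "set es \<subseteq> E - {f}" "walk x es p" using pq by (auto simp: Z_def)
      then show ?thesis using pq unfolding Z_def
        by (intro CollectI exI[of _ "es @ [e]"]) (auto simp: walk_append)
    qed
    have "thin_cut E Z"
      unfolding thin_cut_def
    proof (intro exI[of _ f] ballI impI)
      fix e assume "e \<in> E" "crosses Z e"
      then show "e = f" using step[of "s e" e "t e"] step[of "t e" e "s e"]
        by (auto simp: crosses_def joins_def)
    qed
    then show False using cut[OF ZV] xZ ZU U by auto
  qed
  then obtain es w where es: "set es \<subseteq> E - {f}" "walk x es w" "w \<in> U" by blast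
  obtain fs z where fs: "walk x fs z" "z \<in> U" "set fs \<subseteq> set es" "\<forall>e\<in>set fs. \<not> {s e, t e} \<subseteq> U"
    using walk_stop_at[OF es(2,3)] by blast
  obtain gs where gs: "walk x gs z" "distinct gs" "set gs \<subseteq> set fs"
    using walk_distinct[OF fs(1)] by blast
  have "set gs \<inter> F = {}" using gs(3) fs(4) U by blast
  moreover have "f \<notin> set gs" "set gs \<subseteq> E" using gs fs es by auto
  ultimately have "walk u (f # gs) z \<and> distinct (f # gs) \<and> set (f # gs) \<subseteq> E - F"
    using gs f by auto
  then show ?thesis using f(2) fs(2) by (metis list.distinct(1))
qed

text \<open>A sweep of the largest possible number of edges uses all of them, since otherwise an ear enlarges it.\<close>

lemma sweep_exists:
  assumes fin: "finite E" and sub: "\<And>e. e \<in> E \<Longrightarrow> s e \<in> V \<and> t e \<in> V"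
    and cut: "\<And>Z. Z \<subseteq> V \<Longrightarrow> Z \<noteq> {} \<Longrightarrow> r \<notin> Z \<Longrightarrow> \<not> thin_cut E Z"
  shows "\<exists>es. distinct es \<and> set es = E \<and> sweep {r} es {r}"
proof -
  define P where "P es \<longleftrightarrow> distinct es \<and> set es \<subseteq> E \<and> sweep {r} es {r}" for es
  have "P []" by (simp add: P_def)
  moreover have "length es \<le> card E" if "P es" for es
    using that fin by (metis P_def card_mono distinct_card)
  ultimately obtain es where es: "P es" and max: "\<And>es'. P es' \<Longrightarrow> length es' \<le> length es"
    using ex_has_greatest_nat[of P "[]" length "Suc (card E)"] by (metis le_imp_less_Suc)
  have "set es = E"
  proof (rule ccontr)
    assume "set es \<noteq> E"
    then have F: "set es \<subset> E" using es by (auto simp: P_def)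
    have "\<exists>u\<in>{r} \<union> touched es. \<exists>w\<in>{r} \<union> touched es. \<exists>fs. walk u fs w \<and> distinct fs \<and>
      fs \<noteq> [] \<and> set fs \<subseteq> E - set es"
      by (rule ear_exists[of E V r "set es"]) (use sub cut F in \<open>auto simp: touched_def\<close>)
    then obtain u w fs where fs: "u \<in> {r} \<union> touched es" "w \<in> {r} \<union> touched es" "walk u fs w"
      "distinct fs" "fs \<noteq> []" "set fs \<subseteq> E - set es"
      by blast
    obtain xs ys gs where g: "es = xs @ ys" "gs = fs \<or> gs = rev fs" "sweep {r} (xs @ gs @ ys) {r}"
      using sweep_insert_ear[OF _ fs(1-3)] es by (auto simp: P_def)
    have "P (xs @ gs @ ys)" using g es fs by (auto simp: P_def)
    from max[OF this] show False using g fs by auto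
  qed
  then show ?thesis using es by (auto simp: P_def)
qed

end

section \<open>Bounds on matrices\<close>

text \<open>The \<open>n\<close> by \<open>m\<close> matrix \<open>K\<close>, with row index first, has operator norm at most \<open>c\<close>. Index functions
  are used instead of vectors because the entries are contracted inside sums over assignments.\<close>

definition l2_bounded :: "nat \<Rightarrow> nat \<Rightarrow> (nat \<Rightarrow> nat \<Rightarrow> complex) \<Rightarrow> real \<Rightarrow> bool" where
  "l2_bounded n m K c \<longleftrightarrow> 0 \<le> c \<and>
     (\<forall>x. (\<Sum>b<n. (cmod (\<Sum>a<m. K b a * x a))\<^sup>2) \<le> c\<^sup>2 * (\<Sum>a<m. (cmod (x a))\<^sup>2))"

lemma l2_bounded_nonneg: "l2_bounded n m K c \<Longrightarrow> 0 \<le> c"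
  by (simp add: l2_bounded_def)

lemma l2_boundedD:
  "l2_bounded n m K c \<Longrightarrow> (\<Sum>b<n. (cmod (\<Sum>a<m. K b a * x a))\<^sup>2) \<le> c\<^sup>2 * (\<Sum>a<m. (cmod (x a))\<^sup>2)"
  by (simp add: l2_bounded_def)

text \<open>With \<open>z\<close> the image of \<open>y\<close> under the transpose, \<open>S\<close> the squared norm of \<open>z\<close> and \<open>w\<close> the image of the
  conjugate of \<open>z\<close> under \<open>K\<close>, the number \<open>S\<close> is the pairing of \<open>y\<close> with \<open>w\<close>. The Cauchy-Schwarz
  inequality then bounds \<open>S\<close> by \<open>c\<close> times the norm of \<open>y\<close> times the square root of \<open>S\<close>. This makes
  the direction of an edge irrelevant for its use in a sweep.\<close>

lemma l2_bounded_transpose: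
  assumes "l2_bounded n m K c"
  shows "l2_bounded m n (\<lambda>a b. K b a) c"
  unfolding l2_bounded_def
proof (intro conjI allI)
  show "0 \<le> c" using assms by (rule l2_bounded_nonneg)
  fix y :: "nat \<Rightarrow> complex"
  define z where "z a = (\<Sum>b<n. K b a * y b)" for a
  define w where "w b = (\<Sum>a<m. K b a * cnj (z a))" for b
  define S where "S = (\<Sum>a<m. (cmod (z a))\<^sup>2)"
  define Y where "Y = (\<Sum>b<n. (cmod (y b))\<^sup>2)"
  have "complex_of_real S = (\<Sum>a<m. z a * cnj (z a))"
    unfolding S_def by (simp add: complex_norm_square[symmetric] del: of_real_power)
  also have "\<dots> = (\<Sum>a<m. \<Sum>b<n. y b * (K b a * cnj (z a)))"
    by (subst (1) z_def) (simp add: sum_distrib_left sum_distrib_right mult_ac)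
  also have "\<dots> = (\<Sum>b<n. y b * w b)"
    by (subst sum.swap) (simp add: w_def sum_distrib_left)
  finally have "cmod (complex_of_real S) \<le> (\<Sum>b<n. cmod (y b) * cmod (w b))"
    by (metis (no_types, lifting) norm_mult norm_sum sum.cong)
  then have "S \<le> (\<Sum>b<n. cmod (y b) * cmod (w b))" by simp
  moreover have "0 \<le> S" unfolding S_def by (intro sum_nonneg) simp
  ultimately have "S\<^sup>2 \<le> (\<Sum>b<n. cmod (y b) * cmod (w b))\<^sup>2" by (intro power_mono)
  also have "\<dots> \<le> Y * (\<Sum>b<n. (cmod (w b))\<^sup>2)" unfolding Y_def by (rule Cauchy_Schwarz_ineq_sum)
  also have "\<dots> \<le> Y * (c\<^sup>2 * S)"
    using l2_boundedD[OF assms, of "\<lambda>a. cnj (z a)"]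
    by (intro mult_left_mono) (auto simp: w_def S_def Y_def intro: sum_nonneg)
  finally have "S * S \<le> c\<^sup>2 * Y * S" by (simp add: power2_eq_square mult_ac)
  moreover have "0 \<le> c\<^sup>2 * Y" unfolding Y_def by (intro mult_nonneg_nonneg sum_nonneg) auto
  ultimately have "S \<le> c\<^sup>2 * Y" using \<open>0 \<le> S\<close>
    by (cases "S = 0") (auto simp: mult_le_cancel_right)
  then show "(\<Sum>b<m. (cmod (\<Sum>a<n. K a b * y a))\<^sup>2) \<le> c\<^sup>2 * (\<Sum>a<n. (cmod (y a))\<^sup>2)"
    by (simp add: S_def Y_def z_def)
qed

lemma l2_bounded_column:
  assumes "l2_bounded n m K c" "a < m"
  shows "(\<Sum>b<n. (cmod (K b a))\<^sup>2) \<le> c\<^sup>2"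
proof -
  have "(\<Sum>a'<m. K b a' * (if a' = a then 1 else 0)) = K b a" for b
    using assms(2) by (simp add: if_distrib[of "\<lambda>x. _ * x"] cong: if_cong)
  moreover have "(\<Sum>a'<m. (cmod (if a' = a then 1 else 0))\<^sup>2) = 1"
    using assms(2) by (simp add: if_distrib[of cmod] if_distrib[of "\<lambda>x. x\<^sup>2"] cong: if_cong)
  ultimately show ?thesis
    using l2_boundedD[OF assms(1), of "\<lambda>a'. if a' = a then 1 else 0"] by simp
qed

lemma l2_bounded_row:
  assumes "l2_bounded n m K c" "b < n"
  shows "(cmod (\<Sum>a<m. K b a * x a))\<^sup>2 \<le> c\<^sup>2 * (\<Sum>a<m. (cmod (x a))\<^sup>2)"
proof -
  have "(cmod (\<Sum>a<m. K b a * x a))\<^sup>2 \<le> (\<Sum>b<n. (cmod (\<Sum>a<m. K b a * x a))\<^sup>2)"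
    using assms(2) by (intro member_le_sum[of b "{..<n}" "\<lambda>b. (cmod (\<Sum>a<m. K b a * x a))\<^sup>2"]) auto
  with l2_boundedD[OF assms(1), of x] show ?thesis by linarith
qed

lemma l2_bounded_entry:
  assumes "l2_bounded n m K c" "b < n" "a < m"
  shows "(cmod (K b a))\<^sup>2 \<le> c\<^sup>2"
proof -
  have "(cmod (K b a))\<^sup>2 \<le> (\<Sum>b<n. (cmod (K b a))\<^sup>2)"
    using assms(2) by (intro member_le_sum[of b "{..<n}" "\<lambda>b. (cmod (K b a))\<^sup>2"]) auto
  with l2_bounded_column[OF assms(1,3)] show ?thesis by linarith
qed

lemma vec_l2_norm_vec: "vec_l2_norm (vec k f) = sqrt (\<Sum>i<k. (cmod (f i))\<^sup>2)"
proof -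
  have "cinner (vec k f) (vec k f) = (\<Sum>i<k. complex_of_real ((cmod (f i))\<^sup>2))"
    unfolding cinner_def scalar_prod_def
    by (auto simp: complex_norm_square lessThan_atLeast0 simp del: of_real_power intro!: sum.cong)
  then show ?thesis by (simp add: vec_l2_norm_def)
qed

lemma mult_mat_vec_vec:
  assumes "A \<in> carrier_mat n m"
  shows "A *\<^sub>v vec m x = vec n (\<lambda>b. \<Sum>a<m. A $$ (b, a) * x a)"
  using assms by (intro eq_vecI) (auto simp: scalar_prod_def lessThan_atLeast0 intro!: sum.cong)

text \<open>The supremum defining \<open>op_norm\<close> is an upper bound only if the values of the norm on the unit ball are
  bounded; the Frobenius norm \<open>sqrt C\<close> bounds them.\<close>

lemma l2_bounded_op_norm:
  assumes A: "A \<in> carrier_mat n m"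
  shows "l2_bounded n m (\<lambda>b a. A $$ (b, a)) (op_norm A)"
proof -
  let ?B = "{x \<in> carrier_vec (dim_col A). vec_l2_norm x \<le> 1}"
  let ?y = "\<lambda>x b. \<Sum>a<m. A $$ (b, a) * x a"
  define C where "C = (\<Sum>b<n. \<Sum>a<m. (cmod (A $$ (b, a)))\<^sup>2)"
  have m: "dim_col A = m" using A by auto
  have frob: "(\<Sum>b<n. (cmod (?y x b))\<^sup>2) \<le> C * (\<Sum>a<m. (cmod (x a))\<^sup>2)" for x
    unfolding C_def sum_distrib_right
  proof (rule sum_mono)
    fix b
    have "cmod (?y x b) \<le> (\<Sum>a<m. cmod (A $$ (b, a)) * cmod (x a))"
      by (rule order_trans[OF norm_sum]) (simp add: norm_mult)
    then have "(cmod (?y x b))\<^sup>2 \<le> (\<Sum>a<m. cmod (A $$ (b, a)) * cmod (x a))\<^sup>2"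
      by (intro power_mono) auto
    also have "\<dots> \<le> (\<Sum>a<m. (cmod (A $$ (b, a)))\<^sup>2) * (\<Sum>a<m. (cmod (x a))\<^sup>2)"
      by (rule Cauchy_Schwarz_ineq_sum)
    finally show "(cmod (?y x b))\<^sup>2 \<le> (\<Sum>a<m. (cmod (A $$ (b, a)))\<^sup>2 * (\<Sum>a<m. (cmod (x a))\<^sup>2))"
      by (simp add: sum_distrib_right)
  qed
  have C0: "0 \<le> C" unfolding C_def by (intro sum_nonneg) auto
  have bdd: "bdd_above ((\<lambda>x. vec_l2_norm (A *\<^sub>v x)) ` ?B)"
  proof (rule bdd_aboveI2)
    fix v assume v: "v \<in> ?B"
    then have v_eq: "v = vec m (\<lambda>a. v $ a)" using m by auto
    have "(\<Sum>a<m. (cmod (v $ a))\<^sup>2) \<le> 1"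
      using v v_eq vec_l2_norm_vec[of m "\<lambda>a. v $ a"] by simp
    then have "C * (\<Sum>a<m. (cmod (v $ a))\<^sup>2) \<le> C * 1" using C0 by (intro mult_left_mono)
    then have "(\<Sum>b<n. (cmod (?y (\<lambda>a. v $ a) b))\<^sup>2) \<le> C" using frob[of "\<lambda>a. v $ a"] by simp
    then show "vec_l2_norm (A *\<^sub>v v) \<le> sqrt C"
      by (subst v_eq) (simp add: mult_mat_vec_vec[OF A] vec_l2_norm_vec)
  qed
  have le: "vec_l2_norm (A *\<^sub>v vec m x) \<le> op_norm A" if "(\<Sum>a<m. (cmod (x a))\<^sup>2) \<le> 1" for x
    unfolding op_norm_def using that m
    by (intro cSUP_upper bdd) (auto simp: vec_l2_norm_vec)
  have op0: "0 \<le> op_norm A"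
    using le[of "\<lambda>_. 0"] by (simp add: mult_mat_vec_vec[OF A] vec_l2_norm_vec)
  have "(\<Sum>b<n. (cmod (?y x b))\<^sup>2) \<le> (op_norm A)\<^sup>2 * (\<Sum>a<m. (cmod (x a))\<^sup>2)" for x
  proof (cases "(\<Sum>a<m. (cmod (x a))\<^sup>2) = 0")
    case True
    then show ?thesis using frob[of x] by simp
  next
    case False
    define S where "S = (\<Sum>a<m. (cmod (x a))\<^sup>2)"
    have S: "0 < S" using False unfolding S_def by (metis sum_nonneg zero_le_power2 less_eq_real_def)
    define k where "k = complex_of_real (1 / sqrt S)"
    have k: "(cmod k)\<^sup>2 = 1 / S" using S by (simp add: k_def norm_divide power_divide)
    have "(\<Sum>a<m. (cmod (k * x a))\<^sup>2) = 1"
      using S by (simp add: norm_mult power_mult_distrib k S_def sum_divide_distrib[symmetric])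
    from le[OF eq_refl[OF this]]
    have "sqrt (\<Sum>b<n. (cmod (?y (\<lambda>a. k * x a) b))\<^sup>2) \<le> op_norm A"
      by (simp add: mult_mat_vec_vec[OF A] vec_l2_norm_vec)
    then have "(\<Sum>b<n. (cmod (?y (\<lambda>a. k * x a) b))\<^sup>2) \<le> (op_norm A)\<^sup>2"
      by (rule sqrt_le_D)
    moreover have "?y (\<lambda>a. k * x a) b = k * ?y x b" for b
      by (simp add: sum_distrib_left mult_ac)
    ultimately have "(\<Sum>b<n. (cmod (?y x b))\<^sup>2) / S \<le> (op_norm A)\<^sup>2"
      by (simp add: norm_mult power_mult_distrib k sum_divide_distrib)
    then show ?thesis using S by (simp add: S_def[symmetric] divide_le_eq)
  qed
  then show ?thesis using op0 by (simp add: l2_bounded_def)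
qed

lemma l2_bounded_ones: "l2_bounded 1 k (\<lambda>_ _. 1) (sqrt (real k))"
proof -
  have "(cmod (\<Sum>a<k. x a))\<^sup>2 \<le> real k * (\<Sum>a<k. (cmod (x a))\<^sup>2)" for x :: "nat \<Rightarrow> complex"
  proof -
    have "(cmod (\<Sum>a<k. x a))\<^sup>2 \<le> (\<Sum>a<k. 1 * cmod (x a))\<^sup>2"
      by (intro power_mono) (auto intro: norm_sum)
    also have "\<dots> \<le> (\<Sum>a<k. 1\<^sup>2) * (\<Sum>a<k. (cmod (x a))\<^sup>2)"
      by (rule Cauchy_Schwarz_ineq_sum)
    finally show ?thesis by simp
  qed
  then show ?thesis by (simp add: l2_bounded_def)
qed

lemma cinner_unit_vec_mult_mat:
  assumes "A \<in> carrier_mat n m" "b < n" "a < m"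
  shows "cinner (unit_vec n b) (A *\<^sub>v unit_vec m a) = A $$ (b, a)"
proof -
  have "conjugate (unit_vec n b) = (unit_vec n b :: complex vec)"
    by (intro eq_vecI) (auto simp: unit_vec_def)
  moreover have "row A b \<in> carrier_vec m" using assms by auto
  ultimately show ?thesis using assms
    by (simp add: cinner_def scalar_prod_right_unit[of b n] scalar_prod_right_unit[of a m])
qed

section \<open>Contraction along a sweep\<close>

context
  fixes N :: "'v \<Rightarrow> nat"
begin

definition assignments :: "'v set \<Rightarrow> ('v \<Rightarrow> nat) set" where
  "assignments A = (\<Pi>\<^sub>E v\<in>A. {..<N v})"

text \<open>A tensor with one index for each vertex of \<open>A\<close> is a function on \<open>assignments A\<close>.\<close>

definition sq_norm :: "'v set \<Rightarrow> (('v \<Rightarrow> nat) \<Rightarrow> complex) \<Rightarrow> real" where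
  "sq_norm A \<psi> = (\<Sum>i\<in>assignments A. (cmod (\<psi> i))\<^sup>2)"

lemma sum_assignments_insert:
  assumes "u \<notin> A"
  shows "(\<Sum>i\<in>assignments (insert u A). f i) = (\<Sum>i\<in>assignments A. \<Sum>a<N u. f (i(u := a)))"
proof -
  have "(\<Sum>i\<in>assignments (insert u A). f i) =
    (\<Sum>p\<in>{..<N u} \<times> assignments A. f ((\<lambda>(y, g). g(u := y)) p))"
    unfolding assignments_def PiE_insert_eq
    by (subst sum.reindex) (use inj_combinator[OF assms] in auto)
  also have "\<dots> = (\<Sum>a<N u. \<Sum>i\<in>assignments A. f (i(u := a)))"
    by (subst sum.cartesian_product) (simp add: case_prod_beta)
  finally show ?thesis by (simp add: sum.swap[of _ "assignments A"])
qed

lemma assignments_less: "i \<in> assignments A \<Longrightarrow> v \<in> A \<Longrightarrow> i v < N v"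
  by (auto simp: assignments_def PiE_def Pi_def)

lemma assignments_restrict: "i \<in> assignments A \<Longrightarrow> restrict i A = i"
  by (auto simp: assignments_def PiE_def extensional_restrict)

lemma assignments_upd_restrict: "i \<in> assignments A \<Longrightarrow> u \<notin> A \<Longrightarrow> restrict (i(u := a)) A = i"
  by (auto simp: assignments_def PiE_def extensional_def restrict_def fun_eq_iff)

lemma assignments_upd_restrict_insert:
  "i \<in> assignments A \<Longrightarrow> restrict (i(u := a)) (insert u A) = i(u := a)"
  by (auto simp: assignments_def PiE_def extensional_def restrict_def fun_eq_iff)

text \<open>The step of a sweep along an edge from \<open>u\<close> to \<open>w\<close> with matrix \<open>K\<close>, when the set of active vertices
  changes from \<open>A\<close> to \<open>A'\<close>. The index of \<open>u\<close> is summed over exactly if \<open>u\<close> ceases to be active.\<close>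

definition apply_edge ::
  "'v set \<Rightarrow> 'v set \<Rightarrow> 'v \<Rightarrow> 'v \<Rightarrow> (nat \<Rightarrow> nat \<Rightarrow> complex) \<Rightarrow>
    (('v \<Rightarrow> nat) \<Rightarrow> complex) \<Rightarrow> ('v \<Rightarrow> nat) \<Rightarrow> complex" where
  "apply_edge A A' u w K \<psi> i =
     (if u \<in> A' then K (i w) (i u) * \<psi> (restrict i A)
      else \<Sum>a<N u. K (i w) a * \<psi> (restrict (i(u := a)) A))"

text \<open>Fix the indices of all other vertices and look at those of \<open>u\<close> and \<open>w\<close>. If both persist, the
  tensor is multiplied by entries of \<open>K\<close>; if \<open>u\<close> persists and \<open>w\<close> is new, by a column; if \<open>u\<close> is
  summed out and \<open>w\<close> persists, a row of \<open>K\<close> is applied; and if \<open>u\<close> is summed out and \<open>w\<close> is new, \<open>K\<close>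
  acts as an operator. A loop falls under the first case.\<close>

lemma sq_norm_apply_edge:
  assumes K: "l2_bounded (N w) (N u) K c"
    and A: "u \<in> A" "w \<in> A'" "A - {u} \<subseteq> A'" "A' - {w} \<subseteq> A"
  shows "sq_norm A' (apply_edge A A' u w K \<psi>) \<le> c\<^sup>2 * sq_norm A \<psi>"
proof (cases "u \<in> A'")
  case keep: True
  show ?thesis
  proof (cases "w \<in> A")
    case True
    then have eq: "A' = A" using A keep by auto
    have "(cmod (apply_edge A A' u w K \<psi> i))\<^sup>2 \<le> c\<^sup>2 * (cmod (\<psi> i))\<^sup>2"
      if i: "i \<in> assignments A" for i
    proof -
      have "i w < N w" "i u < N u" using assignments_less[OF i] A True by auto
      from l2_bounded_entry[OF K this] show ?thesis using keep i
        by (simp add: apply_edge_def norm_mult power_mult_distrib assignments_restrict mult_right_mono)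
    qed
    then show ?thesis unfolding sq_norm_def eq sum_distrib_left by (intro sum_mono) auto
  next
    case False
    then have eq: "A' = insert w A" using A keep by auto
    have "(\<Sum>b<N w. (cmod (apply_edge A A' u w K \<psi> (i(w := b))))\<^sup>2) \<le> c\<^sup>2 * (cmod (\<psi> i))\<^sup>2"
      if i: "i \<in> assignments A" for i
    proof -
      have "u \<noteq> w" using A False by auto
      then have "(\<Sum>b<N w. (cmod (apply_edge A A' u w K \<psi> (i(w := b))))\<^sup>2)
          = (\<Sum>b<N w. (cmod (K b (i u)))\<^sup>2) * (cmod (\<psi> i))\<^sup>2"
        using keep False i
        by (simp add: apply_edge_def norm_mult power_mult_distrib sum_distrib_right
            assignments_upd_restrict assignments_restrict)
      also have "\<dots> \<le> c\<^sup>2 * (cmod (\<psi> i))\<^sup>2"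
        using l2_bounded_column[OF K] assignments_less[OF i A(1)] by (intro mult_right_mono) auto
      finally show ?thesis .
    qed
    then show ?thesis
      unfolding sq_norm_def eq sum_assignments_insert[OF False] sum_distrib_left
      by (intro sum_mono) (auto simp: eq)
  qed
next
  case drop: False
  define B where "B = A - {u}"
  have B: "A = insert u B" "u \<notin> B" using A by (auto simp: B_def)
  have uw: "u \<noteq> w" using drop A by auto
  have upd: "restrict (i(u := a)) A = i(u := a)" if "i \<in> assignments B" for i a
    using assignments_upd_restrict_insert[OF that] by (simp add: B)
  have R: "c\<^sup>2 * sq_norm A \<psi> = (\<Sum>i\<in>assignments B. c\<^sup>2 * (\<Sum>a<N u. (cmod (\<psi> (i(u := a))))\<^sup>2))"
    unfolding sq_norm_def B(1) sum_assignments_insert[OF B(2)] sum_distrib_left ..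
  show ?thesis
  proof (cases "w \<in> A")
    case True
    then have eq: "A' = B" using A uw drop by (auto simp: B_def)
    have "(cmod (apply_edge A A' u w K \<psi> i))\<^sup>2 \<le> c\<^sup>2 * (\<Sum>a<N u. (cmod (\<psi> (i(u := a))))\<^sup>2)"
      if i: "i \<in> assignments B" for i
      using l2_bounded_row[OF K assignments_less[OF i, of w], of "\<lambda>a. \<psi> (i(u := a))"] True uw drop
      by (simp add: apply_edge_def upd[OF i] B_def)
    then show ?thesis unfolding R unfolding sq_norm_def eq by (intro sum_mono) auto
  next
    case False
    then have wB: "w \<notin> B" by (simp add: B_def)
    have eq: "A' = insert w B" using A uw drop False by (auto simp: B_def)
    have "(\<Sum>b<N w. (cmod (apply_edge A A' u w K \<psi> (i(w := b))))\<^sup>2)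
        \<le> c\<^sup>2 * (\<Sum>a<N u. (cmod (\<psi> (i(u := a))))\<^sup>2)"
      if i: "i \<in> assignments B" for i
    proof -
      have "restrict (i(w := b, u := a)) A = i(u := a)" for a b
      proof -
        have "restrict (i(w := b, u := a)) A = restrict (i(u := a)) A"
          using False by (auto simp: restrict_def fun_eq_iff)
        then show ?thesis using upd[OF i] by simp
      qed
      then show ?thesis
        using l2_boundedD[OF K, of "\<lambda>a. \<psi> (i(u := a))"] drop by (simp add: apply_edge_def)
    qed
    then show ?thesis unfolding R unfolding sq_norm_def eq sum_assignments_insert[OF wB]
      by (intro sum_mono) (auto simp: eq)
  qed
qed

text \<open>Here \<open>W'\<close> is the set of vertices that are active or met by a later edge, and \<open>Q\<close> is the product
  over the later edges, which does not see the index of a vertex outside \<open>W'\<close>.\<close>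

lemma sum_apply_edge:
  assumes A: "u \<in> A" "w \<in> A'" "A - {u} \<subseteq> A'" "A' - {w} \<subseteq> A" "A' \<subseteq> W'"
    and u: "u \<in> W' \<Longrightarrow> u \<in> A'"
    and Q: "\<And>i a. u \<notin> W' \<Longrightarrow> Q (i(u := a)) = Q i"
  shows "(\<Sum>i\<in>assignments (insert u W'). \<psi> (restrict i A) * (K (i w) (i u) * Q i))
    = (\<Sum>i\<in>assignments W'. apply_edge A A' u w K \<psi> (restrict i A') * Q i)"
proof (cases "u \<in> A'")
  case True
  have "apply_edge A A' u w K \<psi> (restrict i A') = K (i w) (i u) * \<psi> (restrict i A)" for i
  proof -
    have "restrict (restrict i A') A = restrict i A"
      using A True by (auto simp: restrict_def fun_eq_iff)
    then show ?thesis using True A by (simp add: apply_edge_def)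
  qed
  moreover have "insert u W' = W'" using True A by auto
  ultimately show ?thesis by (simp add: mult_ac)
next
  case False
  then have uW: "u \<notin> W'" using u by blast
  have uw: "w \<noteq> u" using False A by auto
  have *: "restrict ((restrict i A')(u := a)) A = restrict (i(u := a)) A" for i a
    using A by (auto simp: restrict_def fun_eq_iff)
  have "(\<Sum>i\<in>assignments (insert u W'). \<psi> (restrict i A) * (K (i w) (i u) * Q i)) =
    (\<Sum>i\<in>assignments W'. \<Sum>a<N u. \<psi> (restrict (i(u := a)) A) * (K (i w) a * Q i))"
    unfolding sum_assignments_insert[OF uW] using uw Q[OF uW] by simp
  also have "\<dots> = (\<Sum>i\<in>assignments W'. apply_edge A A' u w K \<psi> (restrict i A') * Q i)"
    using False by (simp only: apply_edge_def * sum_distrib_right if_False)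
      (intro sum.cong refl, use A in \<open>auto simp: mult_ac\<close>)
  finally show ?thesis .
qed

context
  fixes s t :: "'e \<Rightarrow> 'v" and K :: "'e \<Rightarrow> nat \<Rightarrow> nat \<Rightarrow> complex" and c :: "'e \<Rightarrow> real"
begin

text \<open>The tensor \<open>\<psi>\<close> lives on the active vertices \<open>X \<inter> insert r (touched s t es)\<close>; it holds the
  contribution of the edges before \<open>es\<close>. At the end only the index of the root is left, and summing
  over it costs \<open>sqrt (N r)\<close> by the Cauchy-Schwarz inequality.\<close>

lemma sweep_bound:
  assumes "r \<in> X" "sweep s t X es {r}"
    "\<And>e. e \<in> set es \<Longrightarrow> l2_bounded (N (t e)) (N (s e)) (K e) (c e)"
  shows "cmod (\<Sum>i\<in>assignments (insert r (touched s t es)).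
       \<psi> (restrict i (X \<inter> insert r (touched s t es))) * (\<Prod>e\<leftarrow>es. K e (i (t e)) (i (s e))))
    \<le> (\<Prod>e\<leftarrow>es. c e) * (sqrt (N r) * sqrt (sq_norm (X \<inter> insert r (touched s t es)) \<psi>))"
  using assms
proof (induction es arbitrary: X \<psi>)
  case Nil
  have XA: "X \<inter> {r} = {r}" using Nil by auto
  have card: "card (assignments {r}) = N r" by (simp add: assignments_def card_PiE)
  have "(\<Sum>i\<in>assignments {r}. 1 * cmod (\<psi> i))\<^sup>2 \<le>
    (\<Sum>i\<in>assignments {r}. 1\<^sup>2) * (\<Sum>i\<in>assignments {r}. (cmod (\<psi> i))\<^sup>2)"
    by (rule Cauchy_Schwarz_ineq_sum)
  then have "(\<Sum>i\<in>assignments {r}. cmod (\<psi> i)) \<le> sqrt (N r * sq_norm {r} \<psi>)"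
    by (intro real_le_rsqrt) (simp add: sq_norm_def card)
  moreover have "cmod (\<Sum>i\<in>assignments {r}. \<psi> (restrict i {r})) \<le> (\<Sum>i\<in>assignments {r}. cmod (\<psi> i))"
    by (rule order_trans[OF norm_sum]) (simp add: assignments_restrict)
  ultimately have "cmod (\<Sum>i\<in>assignments {r}. \<psi> (restrict i {r})) \<le> sqrt (N r) * sqrt (sq_norm {r} \<psi>)"
    unfolding real_sqrt_mult by linarith
  then show ?case
    unfolding touched_simps XA list.map prod_list.Nil mult_1_left mult_1_right by simp
next
  case (Cons e es)
  define W' where "W' = insert r (touched s t es)"
  define A where "A = X \<inter> insert r (touched s t (e # es))"
  define A' where "A' = (X \<union> {s e, t e}) \<inter> W'"
  define Q where "Q i = (\<Prod>e\<leftarrow>es. K e (i (t e)) (i (s e)))" for i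
  obtain u w where uw: "u \<in> X" "w \<in> W'" "joins s t e u w" and sw: "sweep s t (X \<union> {s e, t e}) es {r}"
    using Cons.prems(2) by (auto simp: W'_def)
  have ends: "{s e, t e} = {u, w}" using uw(3) by (rule joins_ends)
  have Ke: "l2_bounded (N (t e)) (N (s e)) (K e) (c e)" using Cons.prems(3) by simp
  obtain L where L: "l2_bounded (N w) (N u) L (c e)" "\<And>i. K e (i (t e)) (i (s e)) = L (i w) (i u)"
  proof (cases "s e = u \<and> t e = w")
    case True
    then show ?thesis using that[of "K e"] Ke by auto
  next
    case False
    then have "s e = w \<and> t e = u" using uw(3) by (auto simp: joins_def)
    then show ?thesis using that[of "\<lambda>a b. K e b a"] l2_bounded_transpose[OF Ke] by auto
  qed
  have A_eq: "A = X \<inter> insert u (insert w W')" using ends by (auto simp: A_def W'_def)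
  have AA: "u \<in> A" "w \<in> A'" "A - {u} \<subseteq> A'" "A' - {w} \<subseteq> A" "A' \<subseteq> W'"
    using uw ends unfolding A_eq A'_def by auto
  have W: "insert r (touched s t (e # es)) = insert u W'"
    using ends uw(2) by (auto simp: W'_def)
  have Q_upd: "Q (i(u := a)) = Q i" if "u \<notin> W'" for i a
    using that unfolding Q_def W'_def touched_def
    by (intro arg_cong[where f = prod_list] map_cong) auto
  define \<phi> where "\<phi> = apply_edge A A' u w L \<psi>"
  have "(\<Sum>i\<in>assignments (insert r (touched s t (e # es))).
      \<psi> (restrict i A) * (\<Prod>e\<leftarrow>e # es. K e (i (t e)) (i (s e))))
      = (\<Sum>i\<in>assignments (insert u W'). \<psi> (restrict i A) * (L (i w) (i u) * Q i))"
    by (simp only: W list.map prod_list.Cons L(2) Q_def)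
  also have "\<dots> = (\<Sum>i\<in>assignments W'. \<phi> (restrict i A') * Q i)"
    unfolding \<phi>_def by (rule sum_apply_edge[where Q = Q, OF AA _ Q_upd]) (use uw in \<open>auto simp: A'_def\<close>)
  finally have eq: "(\<Sum>i\<in>assignments (insert r (touched s t (e # es))).
      \<psi> (restrict i A) * (\<Prod>e\<leftarrow>e # es. K e (i (t e)) (i (s e))))
      = (\<Sum>i\<in>assignments W'. \<phi> (restrict i A') * Q i)" .
  have c0: "0 \<le> c e" using Ke by (rule l2_bounded_nonneg)
  have "sqrt (sq_norm A' \<phi>) \<le> sqrt ((c e)\<^sup>2 * sq_norm A \<psi>)"
    unfolding \<phi>_def using sq_norm_apply_edge[OF L(1) AA(1-4)] by simp
  then have step: "sqrt (sq_norm A' \<phi>) \<le> c e * sqrt (sq_norm A \<psi>)"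
    using c0 by (simp add: real_sqrt_mult)
  have pos: "0 \<le> (\<Prod>e\<leftarrow>es. c e)"
    using Cons.prems(3) by (intro prod_list_nonneg) (force intro: l2_bounded_nonneg)
  have "cmod (\<Sum>i\<in>assignments W'. \<phi> (restrict i A') * Q i)
      \<le> (\<Prod>e\<leftarrow>es. c e) * (sqrt (N r) * sqrt (sq_norm A' \<phi>))"
    unfolding A'_def W'_def Q_def
    by (rule Cons.IH[OF _ sw]) (use Cons.prems in auto)
  also have "\<dots> \<le> (\<Prod>e\<leftarrow>es. c e) * (sqrt (N r) * (c e * sqrt (sq_norm A \<psi>)))"
    using pos step by (intro mult_left_mono) auto
  finally show ?case
    unfolding A_def[symmetric] eq unfolding list.map prod_list.Cons by (simp only: mult_ac)
qed

text \<open>The sweep starts with the constant tensor \<open>1\<close> on the root, of norm \<open>sqrt (N r)\<close>; the same factor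
  arises once more at the end.\<close>

theorem contraction_bound:
  assumes fin: "finite V" "finite E" and r: "r \<in> V"
    and sub: "\<And>e. e \<in> E \<Longrightarrow> s e \<in> V \<and> t e \<in> V"
    and cut: "\<And>Z. Z \<subseteq> V \<Longrightarrow> Z \<noteq> {} \<Longrightarrow> r \<notin> Z \<Longrightarrow> \<not> thin_cut s t E Z"
    and bound: "\<And>e. e \<in> E \<Longrightarrow> l2_bounded (N (t e)) (N (s e)) (K e) (c e)"
  shows "cmod (\<Sum>i\<in>assignments V. \<Prod>e\<in>E. K e (i (t e)) (i (s e))) \<le> real (N r) * (\<Prod>e\<in>E. c e)"
proof -
  obtain es where es: "distinct es" "set es = E" "sweep s t {r} es {r}"
    using sweep_exists[OF fin(2) sub cut] by blast
  have V: "V = insert r (touched s t es)"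
  proof
    show "insert r (touched s t es) \<subseteq> V" using r sub es by (auto simp: touched_def)
    show "V \<subseteq> insert r (touched s t es)"
    proof
      fix v assume "v \<in> V"
      show "v \<in> insert r (touched s t es)"
      proof (rule ccontr)
        assume v: "v \<notin> insert r (touched s t es)"
        then have "thin_cut s t E {v}"
          using es by (auto simp: thin_cut_def crosses_def touched_def)
        then show False using cut[of "{v}"] \<open>v \<in> V\<close> v by auto
      qed
    qed
  qed
  have prods: "(\<Prod>e\<in>E. f e) = (\<Prod>e\<leftarrow>es. f e)" for f :: "'e \<Rightarrow> 'z::comm_monoid_mult"
    using prod.distinct_set_conv_list[OF es(1), of f] es(2) by simp
  have one: "sq_norm ({r} \<inter> insert r (touched s t es)) (\<lambda>_. 1) = N r"
    by (simp add: sq_norm_def assignments_def card_PiE)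
  have "cmod (\<Sum>i\<in>assignments V. \<Prod>e\<in>E. K e (i (t e)) (i (s e)))
      \<le> (\<Prod>e\<in>E. c e) * (sqrt (N r) * sqrt (N r))"
    using sweep_bound[OF singletonI es(3), of "\<lambda>_. 1"] bound es(2) unfolding prods V one by simp
  then show ?thesis by (simp add: mult_ac)
qed

end
end

section \<open>Thin cuts and the leaves of the forest of two-edge connected components\<close>

abbreviation arc_crosses :: "('a, 'b) pre_digraph \<Rightarrow> 'a set \<Rightarrow> 'b \<Rightarrow> bool" where
  "arc_crosses G \<equiv> crosses (tail G) (head G)"

abbreviation thin :: "('a, 'b) pre_digraph \<Rightarrow> 'a set \<Rightarrow> bool" where
  "thin G \<equiv> thin_cut (tail G) (head G) (arcs G)"

text \<open>Connectedness and two-edge connectedness are used below only through cuts, for which subgraphs,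
  unions and deletions of arcs are easy to control.\<close>

lemma connected_iff_cut:
  assumes "wf_digraph H"
  shows "Digraph_Component.connected H \<longleftrightarrow> verts H \<noteq> {} \<and>
    (\<forall>Z \<subseteq> verts H. Z \<noteq> {} \<longrightarrow> Z \<noteq> verts H \<longrightarrow> (\<exists>e\<in>arcs H. arc_crosses H Z e))"
    (is "?L \<longleftrightarrow> ?R")
proof
  interpret wf_digraph H by fact
  assume L: ?L
  show ?R
  proof (intro conjI allI impI)
    show "verts H \<noteq> {}" using L by (simp add: connected_conv)
    fix Z assume Z: "Z \<subseteq> verts H" "Z \<noteq> {}" "Z \<noteq> verts H"
    then obtain u v where uv: "u \<in> Z" "v \<in> verts H" "v \<notin> Z" by blast
    have "(u, v) \<in> rtrancl_on (verts H) ((arcs_ends H)\<^sup>s)"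
      using L uv Z by (auto simp: connected_conv)
    then have "v \<in> Z" if "\<not> (\<exists>e\<in>arcs H. arc_crosses H Z e)"
    proof (induction rule: rtrancl_on_induct)
      case base
      then show ?case using uv by simp
    next
      case (step x y)
      then show ?case using that by (auto simp: symcl_def arcs_ends_conv crosses_def)
    qed
    then show "\<exists>e\<in>arcs H. arc_crosses H Z e" using uv by blast
  qed
next
  interpret wf_digraph H by fact
  assume R: ?R
  have "(u, v) \<in> rtrancl_on (verts H) ((arcs_ends H)\<^sup>s)" if uv: "u \<in> verts H" "v \<in> verts H" for u v
  proof -
    define Z where "Z = {x. (u, x) \<in> rtrancl_on (verts H) ((arcs_ends H)\<^sup>s)}"
    have uZ: "u \<in> Z" using uv by (simp add: Z_def)
    have ZH: "Z \<subseteq> verts H" unfolding Z_def by (auto elim: rtrancl_on.cases)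
    have step: "y \<in> Z" if "x \<in> Z" "e \<in> arcs H" "tail H e = x \<and> head H e = y \<or> tail H e = y \<and> head H e = x" for x y e
    proof -
      have "(x, y) \<in> (arcs_ends H)\<^sup>s" using that by (auto simp: symcl_def arcs_ends_conv)
      moreover have "x \<in> verts H" "y \<in> verts H" using that by auto
      ultimately show ?thesis using that unfolding Z_def
        by (auto intro: rtrancl_on_into_rtrancl_on)
    qed
    have "\<not> (\<exists>e\<in>arcs H. arc_crosses H Z e)"
      using step unfolding crosses_def by blast
    then have "Z = verts H" using R uZ ZH by blast
    then show ?thesis using uv by (auto simp: Z_def)
  qed
  then show ?L using R by (auto simp: connected_conv)
qed

lemma two_edge_connected_iff_no_thin_cut:
  assumes "wf_digraph H"
  shows "two_edge_connected H \<longleftrightarrow> verts H \<noteq> {} \<and>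
    (\<forall>Z \<subseteq> verts H. Z \<noteq> {} \<longrightarrow> Z \<noteq> verts H \<longrightarrow> \<not> thin H Z)"
    (is "?L \<longleftrightarrow> ?R")
proof -
  interpret wf_digraph H by fact
  have del: "Digraph_Component.connected (pre_digraph.del_arc H e) \<longleftrightarrow> verts H \<noteq> {} \<and>
    (\<forall>Z \<subseteq> verts H. Z \<noteq> {} \<longrightarrow> Z \<noteq> verts H \<longrightarrow> (\<exists>e'\<in>arcs H - {e}. arc_crosses H Z e'))" for e
    using connected_iff_cut[OF wf_digraph_del_arc, of e] by (simp add: del_arc_def)
  show ?thesis
  proof
    assume L: ?L
    then have conn: "Digraph_Component.connected H" by (simp add: two_edge_connected_def)
    show ?R
    proof (intro conjI allI impI)
      show "verts H \<noteq> {}" using conn connected_iff_cut[OF assms] by blast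
      fix Z assume Z: "Z \<subseteq> verts H" "Z \<noteq> {}" "Z \<noteq> verts H"
      show "\<not> thin H Z"
      proof
        assume "thin H Z"
        then obtain f where f: "\<And>e. e \<in> arcs H \<Longrightarrow> arc_crosses H Z e \<Longrightarrow> e = f"
          by (auto simp: thin_cut_def)
        obtain e where "e \<in> arcs H" "arc_crosses H Z e"
          using conn Z unfolding connected_iff_cut[OF assms] by blast
        then have "f \<in> arcs H" using f by blast
        then have "Digraph_Component.connected (pre_digraph.del_arc H f)"
          using L unfolding two_edge_connected_def disconnecting_edge_def by blast
        then obtain e' where "e' \<in> arcs H - {f}" "arc_crosses H Z e'"
          using Z unfolding del by blast
        then show False using f by blast
      qed
    qed
  next
    assume R: ?R
    have two: "\<exists>e\<in>arcs H - {f}. arc_crosses H Z e"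
      if "Z \<subseteq> verts H" "Z \<noteq> {}" "Z \<noteq> verts H" for Z f
      using R that unfolding thin_cut_def by blast
    have "Digraph_Component.connected (pre_digraph.del_arc H e)" for e
      using R two unfolding del by simp
    moreover have "Digraph_Component.connected H"
      unfolding connected_iff_cut[OF assms]
    proof (intro conjI allI impI)
      show "verts H \<noteq> {}" using R by simp
      fix Z assume "Z \<subseteq> verts H" "Z \<noteq> {}" "Z \<noteq> verts H"
      from two[OF this] show "\<exists>e\<in>arcs H. arc_crosses H Z e" by blast
    qed
    ultimately show ?L by (simp add: two_edge_connected_def disconnecting_edge_def)
  qed
qed

lemma subgraph_antisym_verts_arcs:
  "subgraph H M \<Longrightarrow> verts H = verts M \<Longrightarrow> arcs H = arcs M \<Longrightarrow> H = M"
  by (auto simp: subgraph_def compatible_def intro: pre_digraph.equality)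

lemma max_subgraph_exists:
  assumes "fin_digraph G" "subgraph H G" "P H"
  shows "\<exists>M. pre_digraph.max_subgraph G P M \<and> subgraph H M"
proof -
  interpret fin_digraph G by fact
  define Q where "Q M \<longleftrightarrow> subgraph H M \<and> subgraph M G \<and> P M" for M
  define size where "size M = card (verts M) + card (arcs M)" for M :: "('a, 'b) pre_digraph"
  have fin: "finite (verts M)" "finite (arcs M)" if "subgraph M G" for M
    using that finite_subset[of _ "verts G"] finite_subset[of _ "arcs G"]
    by (auto simp: subgraph_def)
  have "Q H" using assms by (auto simp: Q_def subgraph_def compatible_def)
  moreover have "size M < Suc (size G)" if "Q M" for M
    using that card_mono[of "verts G" "verts M"] card_mono[of "arcs G" "arcs M"]
    by (auto simp: Q_def subgraph_def size_def intro!: le_imp_less_Suc add_mono)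
  ultimately obtain M where M: "Q M" "\<And>M'. Q M' \<Longrightarrow> size M' \<le> size M"
    using ex_has_greatest_nat[of Q H size "Suc (size G)"] by metis
  have "M' = M" if M': "subgraph M M'" "subgraph M' G" "P M'" for M'
  proof -
    have "Q M'" using M' M(1) by (auto simp: Q_def subgraph_def compatible_def)
    from M(2)[OF this] have "size M' \<le> size M" .
    moreover have "card (verts M) \<le> card (verts M')" "card (arcs M) \<le> card (arcs M')"
      using M' fin[OF M'(2)] by (auto simp: subgraph_def intro: card_mono)
    ultimately have "card (verts M) = card (verts M')" "card (arcs M) = card (arcs M')"
      by (auto simp: size_def)
    then have "verts M = verts M'" "arcs M = arcs M'"
      using card_subset_eq[OF fin(1)[OF M'(2)]] card_subset_eq[OF fin(2)[OF M'(2)]] M'(1)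
      unfolding subgraph_def by blast+
    then show ?thesis using subgraph_antisym_verts_arcs[OF M'(1)] by simp
  qed
  then show ?thesis using M(1) by (intro exI[of _ M]) (auto simp: max_subgraph_def Q_def)
qed

lemma subgraph_union:
  assumes "subgraph A G" "subgraph B G"
  shows "subgraph (union A B) G" "subgraph A (union A B)" "subgraph B (union A B)"
  using assms unfolding subgraph_def compatible_def union_def wf_digraph_def by auto

text \<open>A set that contains all or nothing of both \<open>A\<close> and \<open>B\<close> does the same on both sides of the common
  vertex \<open>y\<close>, and hence is trivial in the union. So a cut of the union cuts one of the two parts.\<close>

lemma union_cut:
  assumes "subgraph A G" "subgraph B G" "y \<in> verts A" "y \<in> verts B"
    and Z: "Z \<subseteq> verts (union A B)" "Z \<noteq> {}" "Z \<noteq> verts (union A B)"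
  shows "\<exists>H\<in>{A, B}. Z \<inter> verts H \<noteq> {} \<and> Z \<inter> verts H \<noteq> verts H"
  using assms by (auto simp: union_def)

lemma subgraph_ends:
  assumes "subgraph H G" "e \<in> arcs H"
  shows "tail G e \<in> verts H" "head G e \<in> verts H" "tail H = tail G" "head H = head G" "e \<in> arcs G"
  using assms wf_digraph.wellformed[of H e] by (auto simp: subgraph_def compatible_def)

lemma crosses_inter_subgraph:
  assumes "subgraph H G" "e \<in> arcs H"
  shows "arc_crosses H (Z \<inter> verts H) e \<longleftrightarrow> arc_crosses G Z e"
  using subgraph_ends[OF assms] by (simp add: crosses_def)

lemma thin_inter_subgraph:
  assumes "subgraph H G" "thin G Z"
  shows "thin H (Z \<inter> verts H)"
  using assms(2) crosses_inter_subgraph[OF assms(1)] subgraph_ends(5)[OF assms(1)]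
  unfolding thin_cut_def by blast

lemma subgraph_wf: "subgraph H G \<Longrightarrow> wf_digraph H"
  by (simp add: subgraph_def)

lemma connected_union:
  assumes sub: "subgraph A G" "subgraph B G" and y: "y \<in> verts A" "y \<in> verts B"
    and conn: "Digraph_Component.connected A" "Digraph_Component.connected B"
  shows "Digraph_Component.connected (union A B)"
  unfolding connected_iff_cut[OF subgraph_wf[OF subgraph_union(1)[OF sub]]]
proof (intro conjI allI impI)
  show "verts (union A B) \<noteq> {}" using y by (auto simp: union_def)
  fix Z assume "Z \<subseteq> verts (union A B)" "Z \<noteq> {}" "Z \<noteq> verts (union A B)"
  then obtain H where H: "H \<in> {A, B}" "Z \<inter> verts H \<noteq> {}" "Z \<inter> verts H \<noteq> verts H"
    using union_cut[OF sub y] by blast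
  have su: "subgraph H (union A B)" using H(1) subgraph_union[OF sub] by auto
  have "Digraph_Component.connected H" using H conn by auto
  then obtain e where "e \<in> arcs H" "arc_crosses H (Z \<inter> verts H) e"
    unfolding connected_iff_cut[OF subgraph_wf[OF su]] using H by blast
  then show "\<exists>e\<in>arcs (union A B). arc_crosses (union A B) Z e"
    using crosses_inter_subgraph[OF su] subgraph_ends(5)[OF su] by blast
qed

lemma two_edge_connected_union:
  assumes sub: "subgraph A G" "subgraph B G" and y: "y \<in> verts A" "y \<in> verts B"
    and conn: "two_edge_connected A" "two_edge_connected B"
  shows "two_edge_connected (union A B)"
  unfolding two_edge_connected_iff_no_thin_cut[OF subgraph_wf[OF subgraph_union(1)[OF sub]]]
proof (intro conjI allI impI)
  show "verts (union A B) \<noteq> {}" using y by (auto simp: union_def)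
  fix Z assume "Z \<subseteq> verts (union A B)" "Z \<noteq> {}" "Z \<noteq> verts (union A B)"
  then obtain H where H: "H \<in> {A, B}" "Z \<inter> verts H \<noteq> {}" "Z \<inter> verts H \<noteq> verts H"
    using union_cut[OF sub y] by blast
  have su: "subgraph H (union A B)" using H(1) subgraph_union[OF sub] by auto
  have "two_edge_connected H" using H conn by auto
  then have "\<not> thin H (Z \<inter> verts H)"
    unfolding two_edge_connected_iff_no_thin_cut[OF subgraph_wf[OF su]] using H by blast
  then show "\<not> thin (union A B) Z" using thin_inter_subgraph[OF su] by blast
qed

lemma tec_component_unique:
  assumes "C \<in> tec_components G" "D \<in> tec_components G" "y \<in> verts C" "y \<in> verts D"
  shows "C = D"
proof -
  have C: "subgraph C G" "two_edge_connected C"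
      "\<And>H. subgraph C H \<Longrightarrow> subgraph H G \<Longrightarrow> two_edge_connected H \<Longrightarrow> H = C"
    and D: "subgraph D G" "two_edge_connected D"
      "\<And>H. subgraph D H \<Longrightarrow> subgraph H G \<Longrightarrow> two_edge_connected H \<Longrightarrow> H = D"
    using assms by (auto simp: tec_components_def pre_digraph.max_subgraph_def)
  note u = subgraph_union[OF C(1) D(1)]
    and tec = two_edge_connected_union[OF C(1) D(1) assms(3,4) C(2) D(2)]
  show ?thesis using C(3)[OF u(2,1) tec] D(3)[OF u(3,1) tec] by simp
qed

lemma connected_component_exists:
  assumes "fin_digraph G" "v \<in> verts G"
  shows "\<exists>K\<in>conn_components G. v \<in> verts K"
proof -
  interpret fin_digraph G by fact
  define H where "H = \<lparr>verts = {v}, arcs = {}, tail = tail G, head = head G\<rparr>"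
  have H: "subgraph H G" using assms wf_digraph
    by (auto simp: H_def subgraph_def compatible_def wf_digraph_def)
  have "Digraph_Component.connected H"
    unfolding connected_iff_cut[OF subgraph_wf[OF H]] by (auto simp: H_def)
  from max_subgraph_exists[where P = Digraph_Component.connected, OF assms(1) H this] show ?thesis
    by (auto simp: conn_components_def subgraph_def H_def)
qed

lemma tec_component_exists:
  assumes "fin_digraph G" "v \<in> verts G"
  shows "\<exists>C\<in>tec_components G. v \<in> verts C"
proof -
  interpret fin_digraph G by fact
  define H where "H = \<lparr>verts = {v}, arcs = {}, tail = tail G, head = head G\<rparr>"
  have H: "subgraph H G" using assms wf_digraph
    by (auto simp: H_def subgraph_def compatible_def wf_digraph_def)
  have "two_edge_connected H"
    unfolding two_edge_connected_iff_no_thin_cut[OF subgraph_wf[OF H]] by (auto simp: H_def)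
  from max_subgraph_exists[where P = two_edge_connected, OF assms(1) H this] show ?thesis
    by (auto simp: tec_components_def subgraph_def H_def)
qed

text \<open>Otherwise the union of \<open>K\<close> with the graph consisting of the arc \<open>e\<close> is a larger connected subgraph.\<close>

lemma component_closed_under_arcs:
  assumes K: "K \<in> conn_components G" and e: "e \<in> arcs G" and end_in: "tail G e \<in> verts K \<or> head G e \<in> verts K"
  shows "e \<in> arcs K"
proof -
  have K: "subgraph K G" "Digraph_Component.connected K"
      "\<And>H. subgraph K H \<Longrightarrow> subgraph H G \<Longrightarrow> Digraph_Component.connected H \<Longrightarrow> H = K"
    using assms by (auto simp: conn_components_def pre_digraph.max_subgraph_def)
  interpret wf_digraph G using K by (simp add: subgraph_def)
  define H where "H = \<lparr>verts = {tail G e, head G e}, arcs = {e}, tail = tail G, head = head G\<rparr>"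
  have H: "subgraph H G" using e wf_digraph
    by (auto simp: H_def subgraph_def compatible_def wf_digraph_def)
  have "Digraph_Component.connected H"
    unfolding connected_iff_cut[OF subgraph_wf[OF H]] by (auto simp: H_def crosses_def)
  moreover obtain y where "y \<in> verts K" "y \<in> verts H" using end_in by (auto simp: H_def)
  ultimately have "union K H = K"
    using K(3) connected_union[OF K(1) H] K(2) subgraph_union[OF K(1) H] by blast
  then have "arcs (union K H) = arcs K" by simp
  then show ?thesis by (auto simp: union_def H_def)
qed

lemma two_edge_connected_not_split:
  assumes "subgraph H G" "two_edge_connected H" "thin G Z"
  shows "verts H \<subseteq> Z \<or> verts H \<inter> Z = {}"
proof (rule ccontr)
  assume "\<not> ?thesis"
  then have "Z \<inter> verts H \<noteq> {}" "Z \<inter> verts H \<noteq> verts H" by auto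
  then have "\<not> thin H (Z \<inter> verts H)"
    using assms(2) unfolding two_edge_connected_iff_no_thin_cut[OF subgraph_wf[OF assms(1)]] by blast
  then show False using thin_inter_subgraph[OF assms(1,3)] by simp
qed

text \<open>Deleting \<open>e\<close> leaves no arc between \<open>Z\<close> and its complement, while the component of \<open>e\<close> has vertices
  on both sides.\<close>

lemma thin_cut_arc_is_cutting:
  assumes fin: "fin_digraph G" and Z: "thin G Z" and e: "e \<in> arcs G" "arc_crosses G Z e"
  shows "e \<in> cutting_edges G"
proof -
  interpret fin_digraph G by fact
  obtain K where K: "K \<in> conn_components G" "tail G e \<in> verts K"
    using connected_component_exists[OF fin, of "tail G e"] e by auto
  have eK: "e \<in> arcs K" using component_closed_under_arcs[OF K(1) e(1)] K(2) by simp
  have sub: "subgraph K G" using K(1) by (simp add: conn_components_def max_subgraph_def)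
  have only: "e' = e" if "e' \<in> arcs G" "arc_crosses G Z e'" for e'
    using Z e that unfolding thin_cut_def by blast
  interpret K: wf_digraph K using sub by (rule subgraph_wf)
  have "\<not> Digraph_Component.connected (pre_digraph.del_arc K e)"
  proof
    assume "Digraph_Component.connected (pre_digraph.del_arc K e)"
    then have conn: "\<exists>e'\<in>arcs K - {e}. arc_crosses K Z' e'"
      if "Z' \<subseteq> verts K" "Z' \<noteq> {}" "Z' \<noteq> verts K" for Z'
      using that unfolding connected_iff_cut[OF K.wf_digraph_del_arc]
      by (simp add: K.del_arc_def)
    have "Z \<inter> verts K \<noteq> {}" "Z \<inter> verts K \<noteq> verts K"
      using e(2) subgraph_ends[OF sub eK] by (auto simp: crosses_def)
    then obtain e' where e': "e' \<in> arcs K - {e}" "arc_crosses K (Z \<inter> verts K) e'"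
      using conn[of "Z \<inter> verts K"] by auto
    then show False
      using only crosses_inter_subgraph[OF sub] subgraph_ends(5)[OF sub] by blast
  qed
  then show ?thesis using K(1) eK by (auto simp: cutting_edges_def disconnecting_edge_def)
qed

text \<open>Suppose that a single arc \<open>f\<close> separates \<open>Z'\<close> from the rest of \<open>Z\<close> inside \<open>Z\<close>. The single arc leaving
  \<open>Z\<close> starts in only one of the two parts, so the other part is left by \<open>f\<close> alone, contrary to
  minimality. The component is maximal because a two-edge connected subgraph on more vertices would be
  split by the thin cut \<open>Z\<close>.\<close>

lemma induce_minimal_thin_cut:
  assumes wf: "wf_digraph G" and Z: "Z \<subseteq> verts G" "Z \<noteq> {}" "thin G Z"
    and minimal: "\<And>Z'. Z' \<subset> Z \<Longrightarrow> Z' \<noteq> {} \<Longrightarrow> \<not> thin G Z'"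
  shows "G \<restriction> Z \<in> tec_components G"
proof -
  interpret wf_digraph G by fact
  let ?C = "G \<restriction> Z"
  have sub: "subgraph ?C G" using Z(1) wf
    by (auto simp: induce_subgraph_def subgraph_def compatible_def wf_digraph_def)
  obtain g where g: "\<And>e. e \<in> arcs G \<Longrightarrow> arc_crosses G Z e \<Longrightarrow> e = g"
    using Z(3) by (auto simp: thin_cut_def)
  have "two_edge_connected ?C"
    unfolding two_edge_connected_iff_no_thin_cut[OF subgraph_wf[OF sub]]
  proof (intro conjI allI impI notI)
    show "verts ?C = {} \<Longrightarrow> False" using Z by (simp add: induce_subgraph_def)
    fix Z' assume Z': "Z' \<subseteq> verts ?C" "Z' \<noteq> {}" "Z' \<noteq> verts ?C" "thin ?C Z'"
    then have sub': "Z' \<subset> Z" by (auto simp: induce_subgraph_def)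
    obtain f where f: "\<And>e. e \<in> arcs G \<Longrightarrow> tail G e \<in> Z \<Longrightarrow> head G e \<in> Z \<Longrightarrow>
        arc_crosses G Z' e \<Longrightarrow> e = f"
      using Z'(4) by (auto simp: thin_cut_def induce_subgraph_def)
    \<comment> \<open>By minimality both parts of \<open>Z\<close> are left by arcs other than \<open>f\<close>. These leave \<open>Z\<close>, hence coincide, but they have their inner ends in different parts.\<close>
    obtain e1 where e1: "e1 \<in> arcs G" "arc_crosses G Z' e1" "e1 \<noteq> f"
      using minimal[OF sub' Z'(2)] by (auto simp: thin_cut_def)
    obtain e2 where e2: "e2 \<in> arcs G" "arc_crosses G (Z - Z') e2" "e2 \<noteq> f"
      using minimal[of "Z - Z'"] sub' Z'(2) unfolding thin_cut_def by blast
    have "arc_crosses G Z e1" using f[OF e1(1)] e1 sub' by (auto simp: crosses_def)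
    moreover have "arc_crosses G Z e2" using f[OF e2(1)] e2 sub' by (auto simp: crosses_def)
    ultimately have "e1 = e2" "arc_crosses G Z e1" using g e1 e2 by blast+
    then show False using e1 e2 sub' by (auto simp: crosses_def)
  qed
  moreover have "H = ?C" if H: "subgraph ?C H" "subgraph H G" "two_edge_connected H" for H
  proof -
    have "Z \<subseteq> verts H" using H(1) by (auto simp: subgraph_def induce_subgraph_def)
    then have VH: "verts H = Z" using two_edge_connected_not_split[OF H(2,3) Z(3)] Z(2) by auto
    have "arcs H \<subseteq> arcs ?C" using subgraph_ends[OF H(2)] VH by (auto simp: induce_subgraph_def)
    then have "arcs ?C = arcs H" using H(1) by (auto simp: subgraph_def)
    then show ?thesis using subgraph_antisym_verts_arcs[OF H(1)] VH
      by (simp add: induce_subgraph_def)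
  qed
  ultimately show ?thesis using sub by (auto simp: tec_components_def max_subgraph_def)
qed

lemma finite_tec_components:
  assumes "fin_digraph G"
  shows "finite (tec_components G)"
proof -
  interpret fin_digraph G by fact
  have "tec_components G \<subseteq> (\<lambda>(V, E). \<lparr>verts = V, arcs = E, tail = tail G, head = head G\<rparr>) `
      (Pow (verts G) \<times> Pow (arcs G))"
  proof
    fix C assume "C \<in> tec_components G"
    then have "subgraph C G" by (simp add: tec_components_def max_subgraph_def)
    then show "C \<in> (\<lambda>(V, E). \<lparr>verts = V, arcs = E, tail = tail G, head = head G\<rparr>) `
      (Pow (verts G) \<times> Pow (arcs G))"
      by (intro image_eqI[of _ _ "(verts C, arcs C)"]) (auto simp: subgraph_def compatible_def)
  qed
  then show ?thesis by (rule finite_subset) auto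
qed

lemma verts_tec_forest [simp]: "verts (tec_forest G) = tec_components G"
  by (simp add: tec_forest_def)

lemma tail_head_tec_forest [simp]: "tail (tec_forest G) = fst" "head (tec_forest G) = snd"
  by (simp_all add: tec_forest_def)

lemma arcs_tec_forest: "(C, D) \<in> arcs (tec_forest G) \<longleftrightarrow> C \<in> tec_components G \<and> D \<in> tec_components G \<and> C \<noteq> D \<and>
         (\<exists>e \<in> cutting_edges G.
            (tail G e \<in> verts C \<and> head G e \<in> verts D) \<or>
            (tail G e \<in> verts D \<and> head G e \<in> verts C))"
  by (simp add: tec_forest_def)

lemma fin_digraph_tec_forest:
  assumes "fin_digraph G"
  shows "fin_digraph (tec_forest G)"
proof
  show "finite (verts (tec_forest G))" using finite_tec_components[OF assms] by simp
  have "arcs (tec_forest G) \<subseteq> tec_components G \<times> tec_components G"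
    by (auto simp: arcs_tec_forest)
  then show "finite (arcs (tec_forest G))"
    by (rule finite_subset) (simp add: finite_tec_components[OF assms])
qed (auto simp: arcs_tec_forest)

lemma cutting_edges_subset: "cutting_edges G \<subseteq> arcs G"
  by (auto simp: cutting_edges_def disconnecting_edge_def conn_components_def
      pre_digraph.max_subgraph_def subgraph_def)

lemma leaves_subset_tec_components: "leaves (tec_forest G) \<subseteq> tec_components G"
proof -
  have "l \<in> tec_components G" if "R \<in> conn_components (tec_forest G)" "l \<in> verts R" for R l
    using that by (auto simp: conn_components_def pre_digraph.max_subgraph_def subgraph_def)
  then show ?thesis by (auto simp: leaves_def trivial_leaf_def nontrivial_leaf_def)
qed

lemma forest_arc_crosses:
  assumes "(C, D) \<in> arcs (tec_forest G)"
  shows "\<exists>e\<in>arcs G. arc_crosses G (verts C) e \<and> (tail G e \<in> verts D \<or> head G e \<in> verts D)"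
proof -
  obtain e where CD: "C \<in> tec_components G" "D \<in> tec_components G" "C \<noteq> D"
    and e: "e \<in> cutting_edges G" "tail G e \<in> verts C \<and> head G e \<in> verts D \<or>
      tail G e \<in> verts D \<and> head G e \<in> verts C"
    using assms unfolding arcs_tec_forest by blast
  have "verts C \<inter> verts D = {}" using tec_component_unique[OF CD(1,2)] CD(3) by blast
  then have "arc_crosses G (verts C) e" "tail G e \<in> verts D \<or> head G e \<in> verts D"
    using e(2) by (auto simp: crosses_def)
  moreover have "e \<in> arcs G" using e(1) cutting_edges_subset[of G] by blast
  ultimately show ?thesis by blast
qed

text \<open>An edge of the forest at \<open>C\<close> comes from an arc of \<open>G\<close> that leaves \<open>C\<close>, as distinct components are disjoint.\<close>

lemma isolated_component_is_trivial_leaf: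
  assumes fin: "fin_digraph G" and C: "C \<in> tec_components G"
    and iso: "\<And>e. e \<in> arcs G \<Longrightarrow> \<not> arc_crosses G (verts C) e"
  shows "trivial_leaf (tec_forest G) C"
proof -
  let ?F = "tec_forest G"
  obtain R where R: "R \<in> conn_components ?F" "C \<in> verts R"
    using connected_component_exists[OF fin_digraph_tec_forest[OF fin]] C by auto
  then have sub: "subgraph R ?F" and conn: "Digraph_Component.connected R"
    by (auto simp: conn_components_def pre_digraph.max_subgraph_def)
  have "verts R = {C}"
  proof (rule ccontr)
    assume "verts R \<noteq> {C}"
    then obtain p where p: "p \<in> arcs R" "arc_crosses R {C} p"
      using conn R(2) unfolding connected_iff_cut[OF subgraph_wf[OF sub]] by blast
    have "p \<in> arcs ?F" "fst p = C \<or> snd p = C" using p subgraph_ends[OF sub p(1)]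
      by (auto simp: crosses_def)
    then obtain D where "(C, D) \<in> arcs ?F \<or> (D, C) \<in> arcs ?F" by (cases p) auto
    then have "(C, D) \<in> arcs ?F" unfolding arcs_tec_forest by blast
    then show False using forest_arc_crosses iso by blast
  qed
  then show ?thesis using R(1) by (auto simp: trivial_leaf_def)
qed

text \<open>The only arc leaving \<open>C\<close> is a cutting edge, and its outer end \<open>y\<close> lies in exactly one component
  \<open>D\<close>. Thus \<open>D\<close> is the only neighbour of \<open>C\<close> in the forest.\<close>

lemma single_arc_component_is_nontrivial_leaf:
  assumes fin: "fin_digraph G" and C: "C \<in> tec_components G"
    and thin: "thin G (verts C)" and e: "e \<in> arcs G" "arc_crosses G (verts C) e"
  shows "nontrivial_leaf (tec_forest G) C"
proof -
  interpret fin_digraph G by fact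
  let ?F = "tec_forest G"
  obtain y where y: "y \<in> {tail G e, head G e}" "y \<notin> verts C"
    and in_C: "{tail G e, head G e} - {y} \<subseteq> verts C" "{tail G e, head G e} \<inter> verts C \<noteq> {}"
    using e(2) unfolding crosses_def by blast
  obtain D where D: "D \<in> tec_components G" "y \<in> verts D"
    using tec_component_exists[OF fin, of y] y e by auto
  have CD: "C \<noteq> D" using y D by auto
  have arcF: "(C, D) \<in> arcs ?F"
    using C D CD y in_C thin_cut_arc_is_cutting[OF fin thin e] unfolding arcs_tec_forest by blast
  have only: "D' = D" if D': "(C, D') \<in> arcs ?F" for D'
  proof -
    obtain e' where e': "e' \<in> arcs G" "arc_crosses G (verts C) e'"
      "tail G e' \<in> verts D' \<or> head G e' \<in> verts D'" using forest_arc_crosses[OF D'] by blast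
    have "e' = e" using thin e e' unfolding thin_cut_def by blast
    moreover have "D' \<in> tec_components G" "verts D' \<inter> verts C = {}"
      using D' tec_component_unique[of C G D'] C unfolding arcs_tec_forest by blast+
    ultimately have "y \<in> verts D'" using e' y in_C by blast
    then show ?thesis using tec_component_unique[OF \<open>D' \<in> tec_components G\<close> D(1) _ D(2)] by simp
  qed
  obtain R where R: "R \<in> conn_components ?F" "C \<in> verts R"
    using connected_component_exists[OF fin_digraph_tec_forest[OF fin]] C by auto
  then have sub: "subgraph R ?F"
    by (auto simp: conn_components_def pre_digraph.max_subgraph_def)
  have arcR: "(C, D) \<in> arcs R"
    using component_closed_under_arcs[OF R(1) arcF] R(2) by simp
  have tR: "tail R = fst" using subgraph_ends(3)[OF sub arcR] by simp
  have uniq: "p = (C, D)" if "p \<in> arcs R" "fst p = C" for p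
    using only[of "snd p"] subgraph_ends(5)[OF sub that(1)] that(2) by (cases p) auto
  have "out_arcs R C = {(C, D)}"
  proof (intro equalityI subsetI)
    fix p assume "p \<in> out_arcs R C"
    then have "p \<in> arcs R" "fst p = C" by (simp_all add: out_arcs_def tR)
    from uniq[OF this] show "p \<in> {(C, D)}" by simp
  next
    fix p assume "p \<in> {(C, D)}"
    then show "p \<in> out_arcs R C" using arcR by (simp add: out_arcs_def tR)
  qed
  then have "out_degree R C = 1" by (simp add: out_degree_def)
  moreover have "D \<in> verts R" using subgraph_ends[OF sub arcR] by simp
  ultimately show ?thesis using R CD by (auto simp: nontrivial_leaf_def)
qed

text \<open>A minimal set among the nonempty thin subsets of \<open>Z\<close> is the vertex set of a leaf. The last alternative records that
  a leaf which is not trivial has an arc leaving it.\<close>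

lemma thin_cut_contains_leaf:
  assumes fin: "fin_digraph G" and "Z \<subseteq> verts G" "Z \<noteq> {}" "thin G Z"
  shows "\<exists>C\<in>leaves (tec_forest G). verts C \<subseteq> Z \<and> thin G (verts C) \<and>
    (trivial_leaf (tec_forest G) C \<or> (\<exists>e\<in>arcs G. arc_crosses G (verts C) e))"
proof -
  interpret fin_digraph G by fact
  have "finite Z" using assms(2) finite_verts finite_subset by blast
  then show ?thesis using assms(2-4)
  proof (induction Z rule: finite_psubset_induct)
    case (psubset Z)
    show ?case
    proof (cases "\<exists>Z'\<subset>Z. Z' \<noteq> {} \<and> thin G Z'")
      case True
      then obtain Z' where Z': "Z' \<subset> Z" "Z' \<noteq> {}" "thin G Z'" by blast
      from psubset.IH[OF Z'(1) _ Z'(2,3)] Z'(1) psubset.prems(1) show ?thesis by blast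
    next
      case False
      define C where "C = G \<restriction> Z"
      have C: "C \<in> tec_components G" "verts C = Z"
        using induce_minimal_thin_cut[OF wf_digraph psubset.prems] False
        by (auto simp: C_def induce_subgraph_def)
      show ?thesis
      proof (cases "\<exists>e\<in>arcs G. arc_crosses G (verts C) e")
        case True
        then have "nontrivial_leaf (tec_forest G) C"
          using single_arc_component_is_nontrivial_leaf[OF fin C(1)] C(2) psubset.prems by auto
        then show ?thesis using C(2) True psubset.prems by (auto simp: leaves_def)
      next
        case False
        then have "trivial_leaf (tec_forest G) C"
          using isolated_component_is_trivial_leaf[OF fin C(1)] by blast
        then show ?thesis using C(2) psubset.prems by (auto simp: leaves_def)
      qed
    qed
  qed
qed

section \<open>Closing the graph at its leaves\<close>

context
  fixes G :: "('a, 'b) pre_digraph"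
begin

text \<open>Any vertex of the leaf serves: its dimension is at most the maximum over the leaf.\<close>

definition leaf_vertex :: "('a, 'b) pre_digraph \<Rightarrow> 'a" where
  "leaf_vertex l = (SOME v. v \<in> verts l)"

text \<open>The boolean tells apart the two edges that a trivial leaf sends to the root.\<close>

definition stubs :: "(('a, 'b) pre_digraph \<times> bool) set" where
  "stubs = (SIGMA l : leaves (tec_forest G). if trivial_leaf (tec_forest G) l then UNIV else {False})"

text \<open>The root of the closed graph is \<open>None\<close>, and its edges are the arcs of \<open>G\<close> and the stubs.\<close>

definition closure_tail :: "'b + ('a, 'b) pre_digraph \<times> bool \<Rightarrow> 'a option" where
  "closure_tail = case_sum (\<lambda>e. Some (tail G e)) (\<lambda>p. Some (leaf_vertex (fst p)))"

definition closure_head :: "'b + ('a, 'b) pre_digraph \<times> bool \<Rightarrow> 'a option" where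
  "closure_head = case_sum (\<lambda>e. Some (head G e)) (\<lambda>p. None)"

lemma tec_component_subgraph: "C \<in> tec_components G \<Longrightarrow> subgraph C G \<and> verts C \<noteq> {}"
  by (auto simp: tec_components_def pre_digraph.max_subgraph_def two_edge_connected_def
      connected_conv)

lemma leaf_vertex_in:
  assumes "l \<in> leaves (tec_forest G)"
  shows "leaf_vertex l \<in> verts l" "leaf_vertex l \<in> verts G"
proof -
  have l: "subgraph l G" "verts l \<noteq> {}"
    using assms leaves_subset_tec_components[of G] tec_component_subgraph by auto
  then show "leaf_vertex l \<in> verts l" unfolding leaf_vertex_def by (simp add: some_in_eq)
  then show "leaf_vertex l \<in> verts G" using l(1) by (auto simp: subgraph_def)
qed

text \<open>A set \<open>Y\<close> that violates the claim is thin in \<open>G\<close> and hence contains a leaf, whose stub is the one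
  edge leaving \<open>Y\<close> in the closed graph. So the leaf is not trivial, and no arc of \<open>G\<close> leaves \<open>Y\<close>.
  Removing the leaf from \<open>Y\<close> then gives a nonempty set that is left only by the arc joining it to the
  leaf. This set contains a second leaf, with a second stub.\<close>

lemma closure_no_thin_cut:
  assumes fin: "fin_digraph G" and Z: "Z \<subseteq> Some ` verts G" "Z \<noteq> {}"
  shows "\<not> thin_cut closure_tail closure_head (arcs G <+> stubs) Z"
proof
  assume "thin_cut closure_tail closure_head (arcs G <+> stubs) Z"
  then obtain f where f: "\<And>e. e \<in> arcs G <+> stubs \<Longrightarrow> crosses closure_tail closure_head Z e \<Longrightarrow> e = f"
    unfolding thin_cut_def by blast
  define Y where "Y = {v. Some v \<in> Z}"
  have Y: "Y \<subseteq> verts G" "Y \<noteq> {}" using Z by (auto simp: Y_def)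
  have arc: "Inl e = f" if "e \<in> arcs G" "arc_crosses G Y e" for e
    using f[of "Inl e"] that by (auto simp: crosses_def Y_def closure_tail_def closure_head_def)
  have stub: "Inr (l, b) = f" if "(l, b) \<in> stubs" "leaf_vertex l \<in> Y" for l b
    using f[of "Inr (l, b)"] that Z(1)
    by (auto simp: crosses_def Y_def closure_tail_def closure_head_def)
  have leaf: "Inr (l, False) = f" "\<not> trivial_leaf (tec_forest G) l"
    if l: "l \<in> leaves (tec_forest G)" "verts l \<subseteq> Y" for l
  proof -
    have v: "leaf_vertex l \<in> Y" using leaf_vertex_in[OF l(1)] l(2) by auto
    show F: "Inr (l, False) = f" using stub[OF _ v] l by (simp add: stubs_def)
    show "\<not> trivial_leaf (tec_forest G) l"
    proof
      assume "trivial_leaf (tec_forest G) l"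
      then have "Inr (l, True) = f" using stub[OF _ v] l by (simp add: stubs_def)
      then show False using F by auto
    qed
  qed
  have "thin G Y" unfolding thin_cut_def using arc by (metis sum.sel(1))
  then obtain C where C: "C \<in> leaves (tec_forest G)" "verts C \<subseteq> Y" "thin G (verts C)"
    "trivial_leaf (tec_forest G) C \<or> (\<exists>e\<in>arcs G. arc_crosses G (verts C) e)"
    using thin_cut_contains_leaf[OF fin Y] by blast
  have no_arc: "\<not> arc_crosses G Y e" if "e \<in> arcs G" for e
    using arc[OF that] leaf(1)[OF C(1,2)] by auto
  obtain e where e: "e \<in> arcs G" "arc_crosses G (verts C) e" using C(4) leaf(2)[OF C(1,2)] by blast
  define X where "X = Y - verts C"
  have "X \<noteq> {}" using no_arc[OF e(1)] e(2) C(2) by (auto simp: crosses_def X_def)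
  moreover have "arc_crosses G (verts C) e'" if "e' \<in> arcs G" "arc_crosses G X e'" for e'
    using no_arc[OF that(1)] that(2) C(2) by (auto simp: crosses_def X_def)
  then have "thin G X" using C(3) unfolding thin_cut_def by blast
  ultimately obtain D where D: "D \<in> leaves (tec_forest G)" "verts D \<subseteq> X"
    using thin_cut_contains_leaf[OF fin, of X] Y by (auto simp: X_def)
  then have "Inr (D, False) = f" using leaf(1)[of D] by (auto simp: X_def)
  then have "D = C" using leaf(1)[OF C(1,2)] by auto
  then show False using D(2) leaf_vertex_in(1)[OF C(1)] by (auto simp: X_def)
qed

end

lemma sum_assignments_option:
  "(\<Sum>i\<in>assignments (case_option 1 N) (insert None (Some ` V)). f (\<lambda>v. i (Some v)))
    = (\<Sum>i\<in>assignments N V. f i)"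
proof -
  have "(\<Sum>i\<in>assignments (case_option 1 N) (insert None (Some ` V)). f (\<lambda>v. i (Some v)))
      = (\<Sum>i\<in>assignments (case_option 1 N) (Some ` V). f (\<lambda>v. i (Some v)))"
    by (subst sum_assignments_insert) auto
  also have "\<dots> = (\<Sum>i\<in>assignments N V. f i)"
  proof (rule sum.reindex_bij_witness[of _ "case_option undefined" "\<lambda>i v. i (Some v)"])
    fix i assume i: "i \<in> assignments (case_option 1 N) (Some ` V)"
    then have "i None = undefined" "\<And>v. v \<notin> V \<Longrightarrow> i (Some v) = undefined"
      by (auto simp: assignments_def PiE_def extensional_def)
    moreover have "i (Some v) < N v" if "v \<in> V" for v
      using assignments_less[OF i, of "Some v"] that by simp
    ultimately show "case_option undefined (\<lambda>v. i (Some v)) = i" "(\<lambda>v. i (Some v)) \<in> assignments N V"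
      by (auto simp: assignments_def PiE_def extensional_def fun_eq_iff split: option.split)
  qed (auto simp: assignments_def PiE_def extensional_def split: option.split)
  finally show ?thesis .
qed

section \<open>The bound\<close>

theorem theorem9:
  fixes G :: "('a, 'b) pre_digraph"
    and N :: "'a \<Rightarrow> nat"
    and T :: "'b \<Rightarrow> complex mat"
  assumes "graph_of_matrices G N T"
  shows "cmod (graph_sum G N T)
    \<le> (\<Prod>l \<in> leaves (tec_forest G).
          real (Max (N ` verts l)) powr leaf_exponent (tec_forest G) l)
      * (\<Prod>e \<in> arcs G. op_norm (T e))"
proof -
  interpret graph_of_matrices G N T by fact
  let ?L = "leaves (tec_forest G)"
  let ?V = "insert None (Some ` verts G)" and ?E = "arcs G <+> stubs G" and ?N = "case_option 1 N"
  define K where "K = case_sum (\<lambda>e b a. T e $$ (b, a))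
    (\<lambda>(p :: ('a, 'b) pre_digraph \<times> bool) (b :: nat) (a :: nat). 1)"
  define c where "c = case_sum (\<lambda>e. op_norm (T e))
    (\<lambda>p :: ('a, 'b) pre_digraph \<times> bool. sqrt (real (N (leaf_vertex (fst p)))))"
  have finL: "finite ?L"
    using finite_tec_components[OF fin_digraph] leaves_subset_tec_components[of G]
    by (rule rev_finite_subset)
  then have finS: "finite (stubs G)" by (simp add: stubs_def finite_SigmaI)
  have ends: "closure_tail G e \<in> ?V \<and> closure_head G e \<in> ?V" if "e \<in> ?E" for e
    using that leaf_vertex_in(2)[of _ G]
    by (auto simp: closure_tail_def closure_head_def stubs_def)
  have bound: "l2_bounded (?N (closure_head G e)) (?N (closure_tail G e)) (K e) (c e)"
    if "e \<in> ?E" for e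
    using that l2_bounded_op_norm[OF T_carrier] l2_bounded_ones
    by (auto simp: closure_tail_def closure_head_def K_def c_def)
  have "cmod (\<Sum>i\<in>assignments ?N ?V. \<Prod>e\<in>?E. K e (i (closure_head G e)) (i (closure_tail G e)))
      \<le> real (?N None) * (\<Prod>e\<in>?E. c e)"
  proof (rule contraction_bound[OF _ _ _ ends _ bound])
    show "finite ?V" "finite ?E" "None \<in> ?V" using finS by auto
    fix Z assume "Z \<subseteq> ?V" "Z \<noteq> {}" "None \<notin> Z"
    then show "\<not> thin_cut (closure_tail G) (closure_head G) ?E Z"
      by (intro closure_no_thin_cut[OF fin_digraph]) auto
  qed
  also have "(\<Sum>i\<in>assignments ?N ?V. \<Prod>e\<in>?E. K e (i (closure_head G e)) (i (closure_tail G e)))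
      = (\<Sum>i\<in>assignments ?N ?V. \<Prod>e\<in>arcs G. T e $$ (i (Some (head G e)), i (Some (tail G e))))"
    using finS by (simp add: prod.Plus K_def closure_tail_def closure_head_def)
  also have "\<dots> = (\<Sum>i\<in>assignments N (verts G). \<Prod>e\<in>arcs G. T e $$ (i (head G e), i (tail G e)))"
    using sum_assignments_option[of "\<lambda>i. \<Prod>e\<in>arcs G. T e $$ (i (head G e), i (tail G e))" N "verts G"]
    by simp
  also have "\<dots> = graph_sum G N T"
    unfolding graph_sum_def assignments_def
    by (intro sum.cong prod.cong refl cinner_unit_vec_mult_mat[symmetric] T_carrier)
      (auto simp: PiE_def Pi_def)
  also have "real (?N None) * (\<Prod>e\<in>?E. c e) =
      (\<Prod>p\<in>stubs G. sqrt (real (N (leaf_vertex (fst p))))) * (\<Prod>e\<in>arcs G. op_norm (T e))"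
    using finS by (simp add: prod.Plus c_def mult_ac)
  also have "(\<Prod>p\<in>stubs G. sqrt (real (N (leaf_vertex (fst p)))))
      = (\<Prod>l\<in>?L. real (N (leaf_vertex l)) powr leaf_exponent (tec_forest G) l)"
    unfolding stubs_def using finL
    by (subst prod.Sigma[symmetric, where g = "\<lambda>l b. sqrt (real (N (leaf_vertex l)))", simplified case_prod_unfold])
      (auto intro!: prod.cong simp: leaf_exponent_def powr_half_sqrt UNIV_bool)
  also have "\<dots> * (\<Prod>e\<in>arcs G. op_norm (T e)) \<le>
     (\<Prod>l\<in>?L. real (Max (N ` verts l)) powr leaf_exponent (tec_forest G) l)
      * (\<Prod>e \<in> arcs G. op_norm (T e))"
  proof (rule mult_right_mono)
    have "0 \<le> op_norm (T e)" if "e \<in> arcs G" for e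
      using l2_bounded_nonneg[OF l2_bounded_op_norm[OF T_carrier[OF that]]] .
    then show "0 \<le> (\<Prod>e\<in>arcs G. op_norm (T e))" by (intro prod_nonneg) auto
    have "N (leaf_vertex l) \<le> Max (N ` verts l)" if l: "l \<in> ?L" for l
    proof -
      have "finite (verts l)"
        using leaves_subset_tec_components[of G] tec_component_subgraph[of l G] l
        by (auto simp: subgraph_def intro: finite_subset[OF _ finite_verts])
      then show ?thesis using leaf_vertex_in(1)[OF l] by (intro Max_ge) auto
    qed
    then show "(\<Prod>l\<in>?L. real (N (leaf_vertex l)) powr leaf_exponent (tec_forest G) l)
      \<le> (\<Prod>l\<in>?L. real (Max (N ` verts l)) powr leaf_exponent (tec_forest G) l)"
      by (intro prod_mono conjI powr_mono2) (auto simp: leaf_exponent_def)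
  qed
  finally show ?thesis .
qed

end
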